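(* Let $D$ be a compact metric space with metric $d$, $\lambda$ a non-atomic Radon measure on $D$ and $\mu>0$. Let $\tilde\eta$ be the random finite subset of $D\times\{\mathtt R,\mathtt B\}$ obtained by forgetting the order in the stationary FIFM matching process on $D$; equivalently, $\tilde\eta$ has the Janossy density $\tilde\pi$ given in the context. Let $\tilde\eta^{\mathtt R}$ and $\tilde\eta^{\mathtt B}$ be the point processes on $D$ formed by the positions of its red, respectively blue, points. Then each of $\tilde\eta^{\mathtt R}$ and $\tilde\eta^{\mathtt B}$ is weakly super-Poissonian: writing $\Psi$ for either of them, for all pairwise disjoint Borel sets $B_1,\dots,B_k\subseteq D$ and every Borel set $B\subseteq D$, $$\mathbb E\Big[\prod_{i=1}^k\Psi(B_i)\Big]\ \ge\ \prod_{i=1}^k\mathbb E[\Psi(B_i)]\qquad\text{and}\qquad \mathbb P(\Psi(B)=0)\ \ge\ \exp(-\mathbb E[\Psi(B)]).$$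
   Context: $\mathbf C=\{\mathtt R,\mathtt B\}$, $\bar{\mathtt R}=\mathtt B$, $\bar{\mathtt B}=\mathtt R$; $\bar\lambda=\lambda\otimes m_c$ on $D\times\mathbf C$ with $m_c$ counting measure. For $x=(p_x,c_x)\in D\times\mathbf C$, $N(x)=\{y\in D\times\mathbf C:c_y=\bar c_x,\ d(p_x,p_y)<1\}$, $N(A)=\bigcup_{x\in A}N(x)$. A finite subset $\gamma$ of $D\times\mathbf C$ is valid if $\gamma\cap N(\gamma)=\emptyset$. The law of $\tilde\eta$: for every bounded measurable $F$ on finite subsets of $D\times\mathbf C$, $$\mathbb E F(\tilde\eta)=\sum_{n\ge0}\frac1{n!}\int_{(D\times\mathbf C)^n}F(\{x_1,\dots,x_n\})\,\tilde\pi(\{x_1,\dots,x_n\})\,\bar\lambda^{n}(dx_1\cdots dx_n),$$ where $\tilde\pi(\{x_1,\dots,x_n\})=K\,\mathbf 1(\{x_1,\dots,x_n\}\text{ is valid})\sum_{(X_1,\dots,X_n)}\prod_{i=1}^n\big(\bar\lambda(N(\{X_1,\dots,X_i\}))+i\mu\big)^{-1}$, the sum is over all orderings of $x_1,\dots,x_n$, $\tilde\pi(\emptyset)=K$, and $K$ is the normalizing constant. The FIFM matching process: red and blue particles arrive in $D$ as independent Poisson processes with intensity $\lambda$ per unit time; an arrival is matched with the earliest-arrived present particle of opposite color within distance less than $1$, and both disappear; otherwise it is added as the last element of the ordered list of present particles; each present particle also leaves at rate $\mu$. *)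

theory Defs
  imports "HOL-Probability.Probability" "HOL-Combinatorics.Multiset_Permutations"
begin

definition radon_on :: "'a::metric_space set \<Rightarrow> 'a measure \<Rightarrow> bool" where
  "radon_on D \<Lambda> \<longleftrightarrow>
     sets \<Lambda> = sets (restrict_space borel D) \<and>
     (\<forall>K. K \<subseteq> D \<and> compact K \<longrightarrow> emeasure \<Lambda> K < \<infinity>) \<and>
     (\<forall>A\<in>sets \<Lambda>. emeasure \<Lambda> A = (SUP K\<in>{K. K \<subseteq> A \<and> compact K}. emeasure \<Lambda> K))"

definition non_atomic :: "'a measure \<Rightarrow> bool" where
  "non_atomic \<Lambda> \<longleftrightarrow>
     \<not> (\<exists>A\<in>sets \<Lambda>. emeasure \<Lambda> A > 0 \<and>
           (\<forall>B\<in>sets \<Lambda>. B \<subseteq> A \<longrightarrow> emeasure \<Lambda> B = 0 \<or> emeasure \<Lambda> (A - B) = 0))"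

datatype color = Red | Blue

fun opposite :: "color \<Rightarrow> color" where
  "opposite Red = Blue"
| "opposite Blue = Red"

definition colored_measure :: "'a measure \<Rightarrow> ('a \<times> color) measure" where
  "colored_measure \<Lambda> = \<Lambda> \<Otimes>\<^sub>M count_space UNIV"

definition nbhd :: "'a::metric_space set \<Rightarrow> 'a \<times> color \<Rightarrow> ('a \<times> color) set" where
  "nbhd D x = {y \<in> D \<times> UNIV. snd y = opposite (snd x) \<and> dist (fst x) (fst y) < 1}"

definition nbhds :: "'a::metric_space set \<Rightarrow> ('a \<times> color) set \<Rightarrow> ('a \<times> color) set" where
  "nbhds D A = (\<Union>x\<in>A. nbhd D x)"

definition valid :: "'a::metric_space set \<Rightarrow> ('a \<times> color) set \<Rightarrow> bool" where
  "valid D \<gamma> \<longleftrightarrow> finite \<gamma> \<and> \<gamma> \<subseteq> D \<times> UNIV \<and> \<gamma> \<inter> nbhds D \<gamma> = {}"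

definition unnormalized_density ::
    "'a::metric_space set \<Rightarrow> 'a measure \<Rightarrow> real \<Rightarrow> ('a \<times> color) set \<Rightarrow> real" where
  "unnormalized_density D \<Lambda> \<mu> \<gamma> =
     (if valid D \<gamma>
      then \<Sum>xs\<in>permutations_of_set \<gamma>. \<Prod>i=1..length xs.
             inverse (measure (colored_measure \<Lambda>) (nbhds D (set (take i xs))) + real i * \<mu>)
      else 0)"

(* An n-tuple of colored points is a function on {..<n}. *)
definition normalizing_const :: "'a::metric_space set \<Rightarrow> 'a measure \<Rightarrow> real \<Rightarrow> real" where
  "normalizing_const D \<Lambda> \<mu> =
     inverse (\<Sum>n. 1 / fact n *
       (\<integral>x. unnormalized_density D \<Lambda> \<mu> (x ` {..<n}) \<partial>(\<Pi>\<^sub>M i\<in>{..<n}. colored_measure \<Lambda>)))"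

definition janossy_density ::
    "'a::metric_space set \<Rightarrow> 'a measure \<Rightarrow> real \<Rightarrow> ('a \<times> color) set \<Rightarrow> real" where
  "janossy_density D \<Lambda> \<mu> \<gamma> = normalizing_const D \<Lambda> \<mu> * unnormalized_density D \<Lambda> \<mu> \<gamma>"

(* Finite subsets of a measurable space, with the sigma-algebra generated by the
   counting maps. *)
definition finite_configurations :: "'b measure \<Rightarrow> 'b set measure" where
  "finite_configurations M =
     sigma {\<gamma>. finite \<gamma> \<and> \<gamma> \<subseteq> space M}
           {{\<gamma>. finite \<gamma> \<and> \<gamma> \<subseteq> space M \<and> card (\<gamma> \<inter> A) = n} | A n. A \<in> sets M}"

(* The law of the unordered stationary FIFM configuration, specified by its Janossy density. *)
definition has_fifm_law ::
    "'a::metric_space set \<Rightarrow> 'a measure \<Rightarrow> real \<Rightarrow> 'w measure \<Rightarrow> ('w \<Rightarrow> ('a \<times> color) set) \<Rightarrow> bool"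
  where
  "has_fifm_law D \<Lambda> \<mu> M \<eta> \<longleftrightarrow>
     (\<forall>F :: ('a \<times> color) set \<Rightarrow> real.
        F \<in> borel_measurable (finite_configurations (colored_measure \<Lambda>)) \<and>
        (\<exists>c. \<forall>\<gamma>\<in>space (finite_configurations (colored_measure \<Lambda>)). \<bar>F \<gamma>\<bar> \<le> c) \<longrightarrow>
        (\<lambda>n. 1 / fact n *
           (\<integral>x. F (x ` {..<n}) * janossy_density D \<Lambda> \<mu> (x ` {..<n})
              \<partial>(\<Pi>\<^sub>M i\<in>{..<n}. colored_measure \<Lambda>)))
        sums (\<integral>\<omega>. F (\<eta> \<omega>) \<partial>M))"

definition points_of_color :: "color \<Rightarrow> ('a \<times> color) set \<Rightarrow> 'a set" where
  "points_of_color c \<gamma> = {p. (p, c) \<in> \<gamma>}"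

(* A simple finite point process is represented by the random set of its points. *)
definition weakly_super_poissonian ::
    "'a::metric_space set \<Rightarrow> 'w measure \<Rightarrow> ('w \<Rightarrow> 'a set) \<Rightarrow> bool" where
  "weakly_super_poissonian D M \<Psi> \<longleftrightarrow>
     (\<forall>(k::nat) B. (\<forall>i\<in>{1..k}. B i \<in> sets borel \<and> B i \<subseteq> D) \<and> disjoint_family_on B {1..k} \<longrightarrow>
        (\<integral>\<omega>. (\<Prod>i=1..k. real (card (\<Psi> \<omega> \<inter> B i))) \<partial>M)
          \<ge> (\<Prod>i=1..k. \<integral>\<omega>. real (card (\<Psi> \<omega> \<inter> B i)) \<partial>M)) \<and>
     (\<forall>B. B \<in> sets borel \<and> B \<subseteq> D \<longrightarrow>
        measure M {\<omega> \<in> space M. card (\<Psi> \<omega> \<inter> B) = 0}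
          \<ge> exp (- (\<integral>\<omega>. real (card (\<Psi> \<omega> \<inter> B)) \<partial>M)))"

end

theory Submission
  imports Defs
begin

text \<open>
  Write \<open>f(\<gamma>) = \<lambda>(N(\<gamma>)) + |\<gamma>| \<mu>\<close> and let \<open>W(\<gamma>)\<close> be the sum over all orderings of \<open>\<gamma>\<close> of the product
  of the inverses of \<open>f\<close> over the prefixes, so that \<open>f(\<gamma>) W(\<gamma>)\<close> is the sum of \<open>W(\<gamma> - {x})\<close> over
  \<open>x \<in> \<gamma>\<close>. Order configurations by reversing inclusion for the points of one of the colours.
  For this order \<open>f\<close> is submodular, because \<open>\<lambda>(N(\<gamma>))\<close> is the sum of a red and a blue coverage
  function, and the recursion turns this into log-supermodularity of \<open>W\<close>. Validity of a
  configuration is preserved by the lattice operations, so the Janossy density is log-supermodular too.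

  The Poisson process being diffuse, a product of two integrals over configurations is an integral
  over configurations \<open>\<xi>\<close> of a sum over all splittings \<open>\<xi> = \<Gamma> \<union> (\<xi> - \<Gamma>)\<close>. The product
  \<open>W(\<Gamma>) W(\<xi> - \<Gamma>)\<close> is log-supermodular in \<open>\<Gamma>\<close>, hence the FKG inequality on the finite lattice of
  subsets of \<open>\<xi>\<close> gives positive correlation of increasing statistics with no discretization.
  The product inequality follows by truncating the counts. For void probabilities, cut \<open>B\<close> into
  pieces of small mean \<open>v\<close>, use correlation of the void events and \<open>1 - v \<ge> exp (- v - 2 v^2)\<close>.
\<close>

section \<open>Correlation inequalities on twisted Boolean lattices\<close>

text \<open>Union on \<open>P\<close> and intersection off \<open>P\<close>: the join of the subset
  lattice ordered by \<open>twisted_le P\<close>, that is, by inclusion on \<open>P\<close> and by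
  reversed inclusion off \<open>P\<close>; \<open>twist_meet\<close> is the corresponding
  meet.\<close>

definition twist_join :: "'b set \<Rightarrow> 'b set \<Rightarrow> 'b set \<Rightarrow> 'b set" where
  "twist_join P A B = (A \<inter> B) \<union> ((A \<union> B) \<inter> P)"

definition twist_meet :: "'b set \<Rightarrow> 'b set \<Rightarrow> 'b set \<Rightarrow> 'b set" where
  "twist_meet P A B = (A \<inter> B) \<union> ((A \<union> B) - P)"

definition twisted_le :: "'b set \<Rightarrow> 'b set \<Rightarrow> 'b set \<Rightarrow> bool" where
  "twisted_le P A B \<longleftrightarrow> A \<inter> P \<subseteq> B \<and> B - P \<subseteq> A"

lemma twisted_le_join: "twisted_le P A (twist_join P A B)" "twisted_le P B (twist_join P A B)"
  by (auto simp: twisted_le_def twist_join_def twist_meet_def)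

section \<open>The four functions theorem for the twisted order\<close>

text \<open>The case of a one-point ground set, primes marking the presence of the point. Only the
  mixed terms need an argument: with \<open>p = a' * b\<close>, \<open>q = a * b'\<close> and
  \<open>u = c' * d\<close> one has \<open>p, q \<le> u\<close> and
  \<open>p * q \<le> u * (c * d')\<close>, so expanding \<open>(u - p) * (u - q) \<ge> 0\<close> and
  dividing by \<open>u\<close> gives \<open>p + q \<le> u + c * d'\<close>.\<close>

lemma four_functions_step:
  fixes a b c d a' b' c' d' :: real
  assumes nn: "a \<ge> 0" "b \<ge> 0" "c \<ge> 0" "d \<ge> 0" "a' \<ge> 0" "b' \<ge> 0" "c' \<ge> 0" "d' \<ge> 0"
    and h1: "a * b \<le> c * d" and h2: "a' * b \<le> c' * d" and h3: "a * b' \<le> c' * d"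
    and h4: "a' * b' \<le> c' * d'"
  shows "(a + a') * (b + b') \<le> (c + c') * (d + d')"
proof -
  have "a' * b + a * b' \<le> c' * d + c * d'"
  proof (cases "c' * d = 0")
    case True
    then have "a' * b = 0" "a * b' = 0"
      using h2 h3 nn by (smt (verit) mult_nonneg_nonneg)+
    then have "a' * b + a * b' = 0" by auto
    moreover have "0 \<le> c' * d + c * d'" using nn by simp
    ultimately show ?thesis by linarith
  next
    case False
    then have pos: "c' * d > 0" using nn by (simp add: less_le)
    have prod: "(a' * b) * (a * b') \<le> (c' * d) * (c * d')"
      using mult_mono[OF h1 h4] nn by (simp add: mult_ac)
    have "0 \<le> (c' * d - a' * b) * (c' * d - a * b')"
      using h2 h3 by simp
    then have "(a' * b + a * b') * (c' * d) \<le> (c' * d + c * d') * (c' * d)"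
      using prod by (simp add: algebra_simps)
    then show ?thesis using pos by (rule mult_right_le_imp_le)
  qed
  then show ?thesis using h1 h4 by (simp add: algebra_simps)
qed

lemma join_insert:
  assumes "x \<notin> A" "x \<notin> B" "x \<in> P"
  shows "twist_join P (insert x A) B = insert x (twist_join P A B)" "twist_join P A (insert x B) = insert x (twist_join P A B)"
    "twist_join P (insert x A) (insert x B) = insert x (twist_join P A B)"
    "twist_meet P (insert x A) B = twist_meet P A B" "twist_meet P A (insert x B) = twist_meet P A B"
    "twist_meet P (insert x A) (insert x B) = insert x (twist_meet P A B)"
  using assms by (auto simp: twist_join_def twist_meet_def)

lemma meet_insert:
  assumes "x \<notin> A" "x \<notin> B" "x \<notin> P"
  shows "twist_meet P (insert x A) B = insert x (twist_meet P A B)" "twist_meet P A (insert x B) = insert x (twist_meet P A B)"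
    "twist_meet P (insert x A) (insert x B) = insert x (twist_meet P A B)"
    "twist_join P (insert x A) B = twist_join P A B" "twist_join P A (insert x B) = twist_join P A B"
    "twist_join P (insert x A) (insert x B) = insert x (twist_join P A B)"
  using assms by (auto simp: twist_join_def twist_meet_def)

lemma sum_Pow_insert:
  assumes "finite S" "x \<notin> S"
  shows "(\<Sum>A\<in>Pow (insert x S). f A) = (\<Sum>A\<in>Pow S. f A + f (insert x A) :: real)"
proof -
  have "inj_on (insert x) (Pow S)" using assms by (auto simp: inj_on_def)
  moreover have "Pow S \<inter> insert x ` Pow S = {}" using assms by auto
  ultimately show ?thesis
    using assms by (simp add: Pow_insert sum.union_disjoint sum.reindex sum.distrib)
qed

text \<open>Ahlswede-Daykin by induction on the ground set: adding the values with and without the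
  new point yields four functions on subsets of \<open>S\<close>, and the one-point inequality shows
  that they satisfy the hypothesis again.\<close>

theorem four_functions:
  fixes f1 f2 f3 f4 :: "'b set \<Rightarrow> real"
  assumes "finite S"
    and "\<And>A. A \<subseteq> S \<Longrightarrow> f1 A \<ge> 0" "\<And>A. A \<subseteq> S \<Longrightarrow> f2 A \<ge> 0"
      "\<And>A. A \<subseteq> S \<Longrightarrow> f3 A \<ge> 0" "\<And>A. A \<subseteq> S \<Longrightarrow> f4 A \<ge> 0"
    and "\<And>A B. A \<subseteq> S \<Longrightarrow> B \<subseteq> S \<Longrightarrow> f1 A * f2 B \<le> f3 (twist_join P A B) * f4 (twist_meet P A B)"
  shows "(\<Sum>A\<in>Pow S. f1 A) * (\<Sum>A\<in>Pow S. f2 A) \<le> (\<Sum>A\<in>Pow S. f3 A) * (\<Sum>A\<in>Pow S. f4 A)"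
  using assms
proof (induction S arbitrary: f1 f2 f3 f4 rule: finite_induct)
  case empty
  then show ?case using empty(5)[of "{}" "{}"] by (simp add: twist_join_def twist_meet_def)
next
  case (insert x S)
  show ?case
    unfolding sum_Pow_insert[OF insert.hyps]
  proof (rule insert.IH)
    fix A B assume AB: "A \<subseteq> S" "B \<subseteq> S"
    have x: "x \<notin> A" "x \<notin> B" using AB insert.hyps by auto
    have sub: "insert x A \<subseteq> insert x S" "insert x B \<subseteq> insert x S" "A \<subseteq> insert x S" "B \<subseteq> insert x S"
      "twist_join P A B \<subseteq> insert x S" "twist_meet P A B \<subseteq> insert x S"
      "insert x (twist_join P A B) \<subseteq> insert x S" "insert x (twist_meet P A B) \<subseteq> insert x S"
      using AB by (auto simp: twist_join_def twist_meet_def)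
    note nn = insert.prems(1)[OF sub(3)] insert.prems(1)[OF sub(1)]
      insert.prems(2)[OF sub(4)] insert.prems(2)[OF sub(2)]
      insert.prems(3)[OF sub(5)] insert.prems(3)[OF sub(7)]
      insert.prems(4)[OF sub(6)] insert.prems(4)[OF sub(8)]
    note h = insert.prems(5)[OF sub(3) sub(4)] insert.prems(5)[OF sub(1) sub(4)]
      insert.prems(5)[OF sub(3) sub(2)] insert.prems(5)[OF sub(1) sub(2)]
    show "(f1 A + f1 (insert x A)) * (f2 B + f2 (insert x B))
        \<le> (f3 (twist_join P A B) + f3 (insert x (twist_join P A B))) * (f4 (twist_meet P A B) + f4 (insert x (twist_meet P A B)))"
    proof (cases "x \<in> P")
      case True
      show ?thesis
        by (rule four_functions_step) (use nn h join_insert[OF x True] in auto)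
    next
      case False
      \<comment> \<open>Off \<open>P\<close> it is the meet that takes the new point as soon as one
        argument has it, so \<open>f3\<close> and \<open>f4\<close> exchange roles in the one-point
        inequality.\<close>
      have "(f1 A + f1 (insert x A)) * (f2 B + f2 (insert x B))
          \<le> (f4 (twist_meet P A B) + f4 (insert x (twist_meet P A B))) * (f3 (twist_join P A B) + f3 (insert x (twist_join P A B)))"
        by (rule four_functions_step) (use nn h meet_insert[OF x False] in \<open>auto simp: mult.commute\<close>)
      then show ?thesis by (simp add: mult.commute)
    qed
  qed (auto intro!: add_nonneg_nonneg insert.prems(1-4))
qed

section \<open>Positive correlation over all splittings of a finite set\<close>

lemma sum_Pow_complement: "(\<Sum>A\<in>Pow S. f (S - A)) = (\<Sum>A\<in>Pow S. f A)"
  by (rule sum.reindex_bij_witness[of _ "\<lambda>A. S - A" "\<lambda>A. S - A"]) auto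

lemma complement_join:
  assumes "A \<subseteq> S" "B \<subseteq> S"
  shows "S - twist_join P A B = twist_meet P (S - A) (S - B)" "S - twist_meet P A B = twist_join P (S - A) (S - B)"
  using assms by (auto simp: twist_join_def twist_meet_def)

text \<open>
  The weight \<open>W A * W (S - A)\<close> is log-supermodular and symmetric under complementation, and
  \<open>g (S - A)\<close> is decreasing in \<open>A\<close>: apply the four functions theorem once to \<open>f\<close> and \<open>g\<close>
  and once to \<open>f\<close> and \<open>g (S - A)\<close>.
\<close>

lemma fkg_complementary:
  fixes W f g :: "'b set \<Rightarrow> real"
  assumes fin: "finite S"
    and W0: "\<And>A. A \<subseteq> S \<Longrightarrow> W A \<ge> 0" and f0: "\<And>A. A \<subseteq> S \<Longrightarrow> f A \<ge> 0"
    and g0: "\<And>A. A \<subseteq> S \<Longrightarrow> g A \<ge> 0"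
    and W: "\<And>A B. A \<subseteq> S \<Longrightarrow> B \<subseteq> S \<Longrightarrow> W A * W B \<le> W (twist_join P A B) * W (twist_meet P A B)"
    and f: "\<And>A B. A \<subseteq> S \<Longrightarrow> B \<subseteq> S \<Longrightarrow> twisted_le P A B \<Longrightarrow> f A \<le> f B"
    and g: "\<And>A B. A \<subseteq> S \<Longrightarrow> B \<subseteq> S \<Longrightarrow> twisted_le P A B \<Longrightarrow> g A \<le> g B"
  shows "(\<Sum>A\<in>Pow S. f A * W A * (g (S - A) * W (S - A)))
    \<le> (\<Sum>A\<in>Pow S. f A * g A * W A * W (S - A))"
proof -
  define \<nu> where "\<nu> A = W A * W (S - A)" for A
  define h where "h A = g (S - A)" for A
  have \<nu>0: "\<nu> A \<ge> 0" if "A \<subseteq> S" for A using that W0 by (simp add: \<nu>_def)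
  have h0: "h A \<ge> 0" if "A \<subseteq> S" for A using that g0 by (simp add: h_def)
  have sub: "twist_join P A B \<subseteq> S" "twist_meet P A B \<subseteq> S" if "A \<subseteq> S" "B \<subseteq> S" for A B
    using that by (auto simp: twist_join_def twist_meet_def)
  \<comment> \<open>Complementation exchanges join and meet, so the inequality for \<open>W\<close>
    bounds the complementary factors as well.\<close>
  have \<nu>: "\<nu> A * \<nu> B \<le> \<nu> (twist_join P A B) * \<nu> (twist_meet P A B)" if "A \<subseteq> S" "B \<subseteq> S" for A B
  proof -
    have "(W A * W B) * (W (S - A) * W (S - B))
        \<le> (W (twist_join P A B) * W (twist_meet P A B)) * (W (twist_join P (S - A) (S - B)) * W (twist_meet P (S - A) (S - B)))"
      using that W0 sub by (intro mult_mono W mult_nonneg_nonneg) auto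
    then show ?thesis using complement_join[OF that] by (simp add: \<nu>_def mult_ac)
  qed
  have h: "h A \<le> h (twist_meet P A B)" if "A \<subseteq> S" "B \<subseteq> S" for A B
    unfolding h_def using that sub[OF that]
    by (intro g) (auto simp: twisted_le_def twist_join_def twist_meet_def)
  have up: "(\<Sum>A\<in>Pow S. \<nu> A * f A) * (\<Sum>A\<in>Pow S. \<nu> A * g A)
      \<le> (\<Sum>A\<in>Pow S. \<nu> A * (f A * g A)) * (\<Sum>A\<in>Pow S. \<nu> A)"
  proof (rule four_functions[OF fin, where P = P])
    fix A B assume AB: "A \<subseteq> S" "B \<subseteq> S"
    have "(\<nu> A * \<nu> B) * (f A * g B)
        \<le> (\<nu> (twist_join P A B) * \<nu> (twist_meet P A B)) * (f (twist_join P A B) * g (twist_join P A B))"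
      using AB sub[OF AB] twisted_le_join by (intro mult_mono \<nu> f g mult_nonneg_nonneg \<nu>0 f0 g0) auto
    then show "\<nu> A * f A * (\<nu> B * g B) \<le> \<nu> (twist_join P A B) * (f (twist_join P A B) * g (twist_join P A B)) * \<nu> (twist_meet P A B)"
      by (simp add: mult_ac)
  qed (auto intro!: mult_nonneg_nonneg \<nu>0 f0 g0)
  have down: "(\<Sum>A\<in>Pow S. \<nu> A * (f A * h A)) * (\<Sum>A\<in>Pow S. \<nu> A)
      \<le> (\<Sum>A\<in>Pow S. \<nu> A * f A) * (\<Sum>A\<in>Pow S. \<nu> A * h A)"
  proof (rule four_functions[OF fin, where P = P])
    fix A B assume AB: "A \<subseteq> S" "B \<subseteq> S"
    have "(\<nu> A * \<nu> B) * (f A * h A)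
        \<le> (\<nu> (twist_join P A B) * \<nu> (twist_meet P A B)) * (f (twist_join P A B) * h (twist_meet P A B))"
      using AB sub[OF AB] twisted_le_join by (intro mult_mono \<nu> f h mult_nonneg_nonneg \<nu>0 f0 h0) auto
    then show "\<nu> A * (f A * h A) * \<nu> B \<le> \<nu> (twist_join P A B) * f (twist_join P A B) * (\<nu> (twist_meet P A B) * h (twist_meet P A B))"
      by (simp add: mult_ac)
  qed (auto intro!: mult_nonneg_nonneg \<nu>0 f0 h0)
  have "(\<Sum>A\<in>Pow S. \<nu> A * h A) = (\<Sum>A\<in>Pow S. \<nu> (S - A) * h (S - A))"
    by (rule sum_Pow_complement[symmetric])
  also have "\<dots> = (\<Sum>A\<in>Pow S. \<nu> A * g A)"
    by (intro sum.cong) (auto simp: \<nu>_def h_def double_diff mult.commute)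
  finally have key: "(\<Sum>A\<in>Pow S. \<nu> A * (f A * h A)) * (\<Sum>A\<in>Pow S. \<nu> A)
      \<le> (\<Sum>A\<in>Pow S. \<nu> A * (f A * g A)) * (\<Sum>A\<in>Pow S. \<nu> A)"
    using up down by simp
  have "(\<Sum>A\<in>Pow S. \<nu> A * (f A * h A)) \<le> (\<Sum>A\<in>Pow S. \<nu> A * (f A * g A))"
  proof (cases "(\<Sum>A\<in>Pow S. \<nu> A) = 0")
    case True
    then have "\<nu> A = 0" if "A \<subseteq> S" for A
      using that fin \<nu>0 by (subst (asm) sum_nonneg_eq_0_iff) auto
    then show ?thesis by simp
  next
    case False
    moreover have "(\<Sum>A\<in>Pow S. \<nu> A) \<ge> 0" by (rule sum_nonneg) (auto intro: \<nu>0)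
    ultimately show ?thesis using key by (simp add: mult_le_cancel_right)
  qed
  then show ?thesis by (simp add: \<nu>_def h_def mult_ac)
qed

text \<open>
  A minimal violation \<open>W A * W B = r * (W J * W M)\<close>, \<open>r > 1\<close>, is compared term by term with the
  recursion for the join \<open>J\<close> and meet \<open>M\<close>. A point common to \<open>A\<close> and \<open>B\<close> contributes \<open>a + b\<close> on the left
  and \<open>c + d\<close> on the right, where \<open>a, b \<le> c\<close> and \<open>a b \<le> r c d\<close>, whence \<open>a + b < r (c + d)\<close>.
\<close>

lemma log_supermodular_of_recursion:
  fixes f W :: "'b set \<Rightarrow> real"
  assumes fpos: "\<And>A. finite A \<Longrightarrow> A \<noteq> {} \<Longrightarrow> f A > 0"
    and W_empty: "W {} = 1"
    and rec: "\<And>A. finite A \<Longrightarrow> A \<noteq> {} \<Longrightarrow> f A * W A = (\<Sum>x\<in>A. W (A - {x}))"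
    and f_empty: "f {} = 0"
    and sub: "\<And>A B. finite A \<Longrightarrow> finite B \<Longrightarrow> f (twist_join P A B) + f (twist_meet P A B) \<le> f A + f B"
    and "finite A" "finite B"
  shows "W A * W B \<le> W (twist_join P A B) * W (twist_meet P A B)"
  using \<open>finite A\<close> \<open>finite B\<close>
proof (induction "card A + card B" arbitrary: A B rule: less_induct)
  case less
  \<comment> \<open>Positivity follows from the recursion and allows the ratio \<open>r\<close> to
    be formed.\<close>
  have Wpos: "W A > 0" if "finite A" for A
    using that
  proof (induction A rule: finite_psubset_induct)
    case (psubset A)
    show ?case
    proof (cases "A = {}")
      case False
      then have "f A * W A > 0"
        unfolding rec[OF psubset.hyps False]
        using psubset False by (intro sum_pos psubset.IH) auto
      then show ?thesis using fpos[OF psubset.hyps False] by (simp add: zero_less_mult_iff)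
    qed (simp add: W_empty)
  qed
  have rec': "f A * W A = (\<Sum>x\<in>A. W (A - {x}))" if "finite A" for A
    using that rec f_empty by (cases "A = {}") auto
  define J where "J = twist_join P A B"
  define M where "M = twist_meet P A B"
  have fin: "finite J" "finite M" using less.prems by (auto simp: J_def M_def twist_join_def twist_meet_def)
  have Wp: "W A > 0" "W B > 0" "W J > 0" "W M > 0" using less.prems fin Wpos by auto
  show ?case
  proof (rule ccontr)
    assume "\<not> ?thesis"
    then have gt: "W A * W B > W J * W M" by (simp add: J_def M_def)
    define r where "r = (W A * W B) / (W J * W M)"
    have r: "r > 1" using gt Wp by (simp add: r_def)
    have rQ: "W A * W B = r * (W J * W M)" using Wp by (simp add: r_def)
    \<comment> \<open>\<open>T x\<close> and \<open>U x\<close> collect what the point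
      \<open>x\<close> contributes when the recursion expands
      \<open>(f A + f B) * (W A * W B)\<close> and \<open>(f J + f M) * (W J * W M)\<close>.\<close>
    define T where "T x = (if x \<in> A then W (A - {x}) * W B else 0) + (if x \<in> B then W A * W (B - {x}) else 0)" for x
    define U where "U x = (if x \<in> J then W (J - {x}) * W M else 0) + (if x \<in> M then W J * W (M - {x}) else 0)" for x
    have JM: "J \<union> M = A \<union> B" by (auto simp: J_def M_def twist_join_def twist_meet_def)
    have sumT: "(f A + f B) * (W A * W B) = (\<Sum>x\<in>A \<union> B. T x)"
    proof -
      have "(\<Sum>x\<in>A \<union> B. T x) = (\<Sum>x\<in>A. W (A - {x}) * W B) + (\<Sum>x\<in>B. W A * W (B - {x}))"
        unfolding T_def sum.distrib using less.prems
        by (intro arg_cong2[where f="(+)"] sum.mono_neutral_cong_right) auto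
      also have "\<dots> = (f A * W A) * W B + W A * (f B * W B)"
        using rec' less.prems by (simp add: sum_distrib_left sum_distrib_right)
      finally show ?thesis by (simp add: algebra_simps)
    qed
    have sumU: "(f J + f M) * (W J * W M) = (\<Sum>x\<in>A \<union> B. U x)"
    proof -
      have "(\<Sum>x\<in>A \<union> B. U x) = (\<Sum>x\<in>J. W (J - {x}) * W M) + (\<Sum>x\<in>M. W J * W (M - {x}))"
        unfolding U_def sum.distrib using less.prems fin JM
        by (intro arg_cong2[where f="(+)"] sum.mono_neutral_cong_right) auto
      also have "\<dots> = (f J * W J) * W M + W J * (f M * W M)"
        using rec' fin by (simp add: sum_distrib_left sum_distrib_right)
      finally show ?thesis by (simp add: algebra_simps)
    qed
    have IH_A: "W (A - {x}) * W B \<le> W (twist_join P (A - {x}) B) * W (twist_meet P (A - {x}) B)" if "x \<in> A" for x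
      using less.hyps[of "A - {x}" B] that less.prems card_Diff1_less[of A x] by auto
    have IH_B: "W A * W (B - {x}) \<le> W (twist_join P A (B - {x})) * W (twist_meet P A (B - {x}))" if "x \<in> B" for x
      using less.hyps[of A "B - {x}"] that less.prems card_Diff1_less[of B x] by auto
    have IH_AB: "W (A - {x}) * W (B - {x}) \<le> W (twist_join P (A - {x}) (B - {x})) * W (twist_meet P (A - {x}) (B - {x}))"
      if "x \<in> A" "x \<in> B" for x
      using less.hyps[of "A - {x}" "B - {x}"] that less.prems card_Diff1_less[of A x] card_Diff1_less[of B x]
      by auto
    have four: "a + b < r * (c + d)"
      if "a \<le> c" "b \<le> c" "a * b \<le> r * (c * d)" "c > 0" "d > 0" for a b c d :: real
    proof -
      have "0 \<le> (c - a) * (c - b)" using that by simp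
      then have "(a + b) * c \<le> c * c + r * (c * d)" using that(3) by (simp add: algebra_simps)
      also have "\<dots> = (c + r * d) * c" by (simp add: algebra_simps)
      finally have "a + b \<le> c + r * d" using \<open>c > 0\<close> by simp
      also have "\<dots> < r * (c + d)" using r \<open>c > 0\<close> by (simp add: algebra_simps)
      finally show ?thesis .
    qed
    have TU: "T x < r * U x" if x: "x \<in> A \<union> B" for x
    proof -
      have pos: "W (J - {x}) * W M > 0" "W J * W (M - {x}) > 0" using Wp Wpos fin by auto
      have lt: "t < r * u" if "t \<le> u" "u > 0" for t u :: real
        by (rule le_less_trans[OF that(1)]) (use that r in simp)
      consider (AB) "x \<in> A" "x \<in> B" | (A) "x \<in> A" "x \<notin> B" | (B) "x \<notin> A" "x \<in> B" using x by auto
      then show ?thesis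
      proof cases
        case AB
        then have mem: "x \<in> J" "x \<in> M" by (auto simp: J_def M_def twist_join_def twist_meet_def)
        have eq: "twist_join P (A - {x}) (B - {x}) = J - {x}" "twist_meet P (A - {x}) (B - {x}) = M - {x}"
          using AB by (auto simp: J_def M_def twist_join_def twist_meet_def)
        have prod: "(W (A - {x}) * W B) * (W A * W (B - {x})) \<le> r * ((W (J - {x}) * W M) * (W J * W (M - {x})))"
        proof -
          have "(W (A - {x}) * W (B - {x})) * (W A * W B) \<le> (W (J - {x}) * W (M - {x})) * (W A * W B)"
            using IH_AB[OF AB] Wp unfolding eq by (intro mult_right_mono) auto
          also have "\<dots> = r * ((W (J - {x}) * W M) * (W J * W (M - {x})))"
            unfolding rQ by (simp add: mult_ac)
          finally show ?thesis by (simp only: mult_ac)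
        qed
        show ?thesis
        proof (cases "x \<in> P")
          case True
          \<comment> \<open>Inside \<open>P\<close>, a point still present in the other set stays in
            the join, so removing it from one set shrinks only the meet. Off \<open>P\<close> only
            the join shrinks, and the two terms of \<open>U x\<close> exchange roles.\<close>
          have "twist_join P (A - {x}) B = J" "twist_meet P (A - {x}) B = M - {x}"
            "twist_join P A (B - {x}) = J" "twist_meet P A (B - {x}) = M - {x}"
            using AB True by (auto simp: J_def M_def twist_join_def twist_meet_def)
          then show ?thesis
            using four[of "W (A - {x}) * W B" "W J * W (M - {x})" "W A * W (B - {x})" "W (J - {x}) * W M"]
              IH_A[of x] IH_B[of x] AB mem pos prod by (simp add: T_def U_def mult.commute[of _ "W J * W (M - {x})"] add.commute[of "W (J - {x}) * W M"])
        next
          case False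
          have "twist_join P (A - {x}) B = J - {x}" "twist_meet P (A - {x}) B = M"
            "twist_join P A (B - {x}) = J - {x}" "twist_meet P A (B - {x}) = M"
            using AB False by (auto simp: J_def M_def twist_join_def twist_meet_def)
          then show ?thesis
            using four[of "W (A - {x}) * W B" "W (J - {x}) * W M" "W A * W (B - {x})" "W J * W (M - {x})"]
              IH_A[of x] IH_B[of x] AB mem pos prod by (simp add: T_def U_def)
        qed
      next
        \<comment> \<open>A point of only one of the two sets lies in only one of join and meet, so
          a single inductive comparison suffices and \<open>r > 1\<close> makes it strict.\<close>
        case A
        show ?thesis
        proof (cases "x \<in> P")
          case True
          have "twist_join P (A - {x}) B = J - {x}" "twist_meet P (A - {x}) B = M" "x \<in> J" "x \<notin> M"
            using A True by (auto simp: J_def M_def twist_join_def twist_meet_def)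
          then show ?thesis
            using IH_A[of x] A pos lt by (simp add: T_def U_def)
        next
          case False
          have "twist_join P (A - {x}) B = J" "twist_meet P (A - {x}) B = M - {x}" "x \<notin> J" "x \<in> M"
            using A False by (auto simp: J_def M_def twist_join_def twist_meet_def)
          then show ?thesis
            using IH_A[of x] A pos lt by (simp add: T_def U_def)
        qed
      next
        case B
        show ?thesis
        proof (cases "x \<in> P")
          case True
          have "twist_join P A (B - {x}) = J - {x}" "twist_meet P A (B - {x}) = M" "x \<in> J" "x \<notin> M"
            using B True by (auto simp: J_def M_def twist_join_def twist_meet_def)
          then show ?thesis
            using IH_B[of x] B pos lt by (simp add: T_def U_def)
        next
          case False
          have "twist_join P A (B - {x}) = J" "twist_meet P A (B - {x}) = M - {x}" "x \<notin> J" "x \<in> M"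
            using B False by (auto simp: J_def M_def twist_join_def twist_meet_def)
          then show ?thesis
            using IH_B[of x] B pos lt by (simp add: T_def U_def)
        qed
      qed
    qed
    have ne: "A \<union> B \<noteq> {}"
    proof
      assume "A \<union> B = {}"
      then have "A = {}" "B = {}" "J = {}" "M = {}" by (auto simp: J_def M_def twist_join_def twist_meet_def)
      then show False using gt by simp
    qed
    \<comment> \<open>Summing over the points and cancelling \<open>W A * W B > 0\<close>
      contradicts submodularity of \<open>f\<close>.\<close>
    have "(f A + f B) * (W A * W B) < r * (\<Sum>x\<in>A \<union> B. U x)"
      unfolding sumT sum_distrib_left using TU ne less.prems by (intro sum_strict_mono) auto
    also have "\<dots> = (f J + f M) * (W A * W B)"
      unfolding sumU[symmetric] by (simp add: rQ)
    finally have "f A + f B < f J + f M" using Wp by simp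
    then show False using sub[OF less.prems] by (simp add: J_def M_def)
  qed
qed

section \<open>Integration over finite configurations of a diffuse measure\<close>

text \<open>A measurable diagonal makes the coincidence of two entries of a tuple an event, and null
  singletons make this event null. Almost every tuple can thus be treated as a set of distinct
  points.\<close>

locale diffuse_space = finite_measure X for X :: "'b measure" +
  assumes diagonal: "{z \<in> space (X \<Otimes>\<^sub>M X). fst z = snd z} \<in> sets (X \<Otimes>\<^sub>M X)"
    and singleton_null: "y \<in> space X \<Longrightarrow> emeasure X {y} = 0"
begin

sublocale prod: product_sigma_finite "\<lambda>_ :: nat. X"
  by unfold_locales

section \<open>Tuples of points and their images\<close>

abbreviation tuples :: "nat set \<Rightarrow> (nat \<Rightarrow> 'b) measure" where
  "tuples I \<equiv> Pi\<^sub>M I (\<lambda>_. X)"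

lemma space_tuplesD: "x \<in> space (tuples I) \<Longrightarrow> i \<in> I \<Longrightarrow> x i \<in> space X"
  by (auto simp: space_PiM)

text \<open>A singleton is a section of the diagonal.\<close>

lemma singleton_sets: "y \<in> space X \<Longrightarrow> {y} \<in> sets X"
  using sets_Pair1[OF diagonal, of y]
  by (rule back_subst[where P = "\<lambda>A. A \<in> sets X"]) (auto simp: space_pair_measure)

lemma coincidence_sets:
  assumes "i \<in> I" "j \<in> I"
  shows "{x \<in> space (tuples I). x i = x j} \<in> sets (tuples I)"
proof -
  have m: "(\<lambda>x. (x i, x j)) \<in> tuples I \<rightarrow>\<^sub>M X \<Otimes>\<^sub>M X"
    using assms by measurable
  have "{x \<in> space (tuples I). x i = x j}
      = (\<lambda>x. (x i, x j)) -` {z \<in> space (X \<Otimes>\<^sub>M X). fst z = snd z} \<inter> space (tuples I)"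
    using assms by (auto simp: space_pair_measure space_tuplesD)
  then show ?thesis using measurable_sets[OF m diagonal] by simp
qed

lemma injective_sets:
  assumes "finite I"
  shows "{x \<in> space (tuples I). inj_on x I} \<in> sets (tuples I)"
proof -
  have "{x \<in> space (tuples I). inj_on x I}
      = {x \<in> space (tuples I). \<forall>i\<in>I. \<forall>j\<in>I. i \<noteq> j \<longrightarrow> \<not> x i = x j}"
    by (auto simp: inj_on_def)
  also have "\<dots> \<in> sets (tuples I)"
    using assms
    by (intro sets.sets_Collect_finite_All sets.sets_Collect_imp sets.sets_Collect_neg
        sets.sets_Collect_const coincidence_sets) auto
  finally show ?thesis .
qed

text \<open>For each pair of indices, integrate out coordinate \<open>i\<close> first: with the
  others fixed, coincidence confines it to the null set \<open>{x j}\<close>.\<close>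

lemma AE_injective:
  assumes "finite I"
  shows "AE x in tuples I. inj_on x I"
proof -
  have "AE x in tuples I. x i \<noteq> x j" if ij: "i \<in> I" "j \<in> I" "i \<noteq> j" for i j
  proof -
    let ?N = "{x \<in> space (tuples I). x i = x j}"
    have N: "?N \<in> sets (tuples I)" using ij by (intro coincidence_sets)
    have I: "insert i (I - {i}) = I" using ij by auto
    have "emeasure (tuples I) ?N = (\<integral>\<^sup>+ x. indicator ?N x \<partial>tuples I)" using N by simp
    also have "\<dots> = (\<integral>\<^sup>+ x. (\<integral>\<^sup>+ y. indicator ?N (x(i := y)) \<partial>X) \<partial>tuples (I - {i}))"
      using prod.product_nn_integral_insert[of "I - {i}" i "indicator ?N"] N assms unfolding I by simp
    also have "\<dots> = (\<integral>\<^sup>+ x. 0 \<partial>tuples (I - {i}))"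
    proof (intro nn_integral_cong)
      fix x assume x: "x \<in> space (tuples (I - {i}))"
      then have xj: "x j \<in> space X" using space_tuplesD[OF x, of j] ij by auto
      have "(\<integral>\<^sup>+ y. indicator ?N (x(i := y)) \<partial>X) \<le> (\<integral>\<^sup>+ y. indicator {x j} y \<partial>X)"
      proof (intro nn_integral_mono)
        fix y
        show "indicator ?N (x(i := y)) \<le> (indicator {x j} y :: ennreal)"
          using ij by (cases "y = x j") (auto simp: indicator_def)
      qed
      also have "\<dots> = emeasure X {x j}"
        using singleton_sets[OF xj] by simp
      finally show "(\<integral>\<^sup>+ y. indicator ?N (x(i := y)) \<partial>X) = 0"
        using singleton_null[OF xj] by simp
    qed
    finally have "emeasure (tuples I) ?N = 0" by simp
    then show ?thesis using N by (intro AE_I[of _ _ ?N]) auto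
  qed
  then have "AE x in tuples I. \<forall>i\<in>I. \<forall>j\<in>I. i \<noteq> j \<longrightarrow> x i \<noteq> x j"
    using assms by (auto simp: AE_finite_all)
  then show ?thesis by eventually_elim (auto simp: inj_on_def)
qed

text \<open>
  On tuples with a repeated entry the image loses an index, so only injective tuples need a
  measurable formula.
\<close>

lemma measurable_image_induct:
  fixes H :: "'b set \<Rightarrow> 'c" and I :: "nat set"
  assumes "finite I"
    and step: "\<And>I. finite I \<Longrightarrow> (\<And>i. i \<in> I \<Longrightarrow> (\<lambda>x. H (x ` (I - {i}))) \<in> tuples (I - {i}) \<rightarrow>\<^sub>M N)
      \<Longrightarrow> \<exists>g \<in> tuples I \<rightarrow>\<^sub>M N. \<forall>x\<in>space (tuples I). inj_on x I \<longrightarrow> H (x ` I) = g x"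
  shows "(\<lambda>x. H (x ` I)) \<in> tuples I \<rightarrow>\<^sub>M N"
  using \<open>finite I\<close>
proof (induction I rule: finite_psubset_induct)
  case (psubset I)
  have sub: "(\<lambda>x. H (x ` (I - {i}))) \<in> tuples (I - {i}) \<rightarrow>\<^sub>M N" if "i \<in> I" for i
    using that by (intro psubset.IH) auto
  from step[OF psubset.hyps sub] obtain g where g: "g \<in> tuples I \<rightarrow>\<^sub>M N"
    "\<And>x. x \<in> space (tuples I) \<Longrightarrow> inj_on x I \<Longrightarrow> H (x ` I) = g x" by blast
  \<comment> \<open>Finitely many measurable pieces cover the tuples. They may overlap, since gluing
    only asks for a countable measurable cover.\<close>
  define C where "C = insert {x \<in> space (tuples I). inj_on x I}
    ((\<lambda>(i, j). {x \<in> space (tuples I). x i = x j}) ` {(i, j) \<in> I \<times> I. i \<noteq> j})"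
  have fin: "finite {(i, j) \<in> I \<times> I. i \<noteq> j}"
    by (rule finite_subset[of _ "I \<times> I"]) (use psubset.hyps in auto)
  show ?case
  proof (rule measurable_piecewise_restrict[of C])
    show "countable C" using fin by (auto simp: C_def intro: countable_finite)
    show "\<Omega> \<inter> space (tuples I) \<in> sets (tuples I)" if "\<Omega> \<in> C" for \<Omega>
      using that injective_sets[OF psubset.hyps] coincidence_sets by (auto simp: C_def)
    show "space (tuples I) \<subseteq> \<Union> C" by (auto simp: C_def inj_on_def)
    fix \<Omega> assume "\<Omega> \<in> C"
    then consider (inj) "\<Omega> = {x \<in> space (tuples I). inj_on x I}"
      | (eq) i j where "i \<in> I" "j \<in> I" "i \<noteq> j" "\<Omega> = {x \<in> space (tuples I). x i = x j}"
      by (auto simp: C_def)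
    then show "(\<lambda>x. H (x ` I)) \<in> restrict_space (tuples I) \<Omega> \<rightarrow>\<^sub>M N"
    proof cases
      case inj
      show ?thesis
        by (rule measurable_cong[THEN iffD2, OF _ measurable_restrict_space1[OF g(1)]])
          (use inj g(2) in \<open>auto simp: space_restrict_space\<close>)
    next
      case eq
      have "(\<lambda>x. restrict x (I - {i})) \<in> tuples I \<rightarrow>\<^sub>M tuples (I - {i})"
        by (rule measurable_restrict_subset) auto
      from measurable_compose[OF this sub[OF eq(1)]]
      have m: "(\<lambda>x. H (restrict x (I - {i}) ` (I - {i}))) \<in> tuples I \<rightarrow>\<^sub>M N" .
      show ?thesis
      proof (rule measurable_cong[THEN iffD2, OF _ measurable_restrict_space1[OF m]])
        fix x assume "x \<in> space (restrict_space (tuples I) \<Omega>)"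
        then have "x i = x j" using eq by (auto simp: space_restrict_space)
        then have "x i \<in> x ` (I - {i})" using eq by (intro image_eqI[of _ _ j]) auto
        moreover have "x ` I = insert (x i) (x ` (I - {i}))" using eq by blast
        ultimately have "x ` I = restrict x (I - {i}) ` (I - {i})" by auto
        then show "H (x ` I) = H (restrict x (I - {i}) ` (I - {i}))" by simp
      qed
    qed
  qed
qed

text \<open>Relabelling along a bijection \<open>h\<close> carries one product measure to the other,
  and \<open>H\<close> sees only the image of the tuple, which relabelling keeps.\<close>

lemma integral_tuples_card:
  assumes IJ: "finite I" "finite J" "card I = card J"
    and H: "(\<lambda>x. H (x ` I)) \<in> borel_measurable (tuples I)"
  shows "(\<integral>x. H (x ` J) \<partial>tuples J) = (\<integral>x. H (x ` I) \<partial>tuples I :: real)"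
proof -
  obtain h where h: "bij_betw h I J" using finite_same_card_bij[OF IJ] by blast
  let ?T = "\<lambda>x. \<lambda>i\<in>I. x (h i)"
  have hJ: "h i \<in> J" if "i \<in> I" for i using h that by (auto simp: bij_betw_def)
  have T: "?T \<in> tuples J \<rightarrow>\<^sub>M tuples I"
    using hJ by (intro measurable_restrict measurable_component_singleton) auto
  have "distr (tuples J) (tuples I) ?T = tuples I"
  proof (rule prod.PiM_eqI[OF IJ(1)])
    fix A :: "nat \<Rightarrow> 'b set" assume A: "\<And>i. i \<in> I \<Longrightarrow> A i \<in> sets X"
    let ?k = "the_inv_into I h"
    have k: "?k (h i) = i" if "i \<in> I" for i
      using that h by (auto simp: bij_betw_def the_inv_into_f_f)
    have k': "?k j \<in> I \<and> h (?k j) = j" if "j \<in> J" for j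
      using that h k by (auto simp: bij_betw_def)
    have "?T -` Pi\<^sub>E I A \<inter> space (tuples J) = Pi\<^sub>E J (\<lambda>j. A (?k j))"
    proof (intro equalityI subsetI)
      fix x assume x: "x \<in> ?T -` Pi\<^sub>E I A \<inter> space (tuples J)"
      show "x \<in> Pi\<^sub>E J (\<lambda>j. A (?k j))"
      proof (rule PiE_I)
        fix j assume "j \<in> J"
        then show "x j \<in> A (?k j)" using x k'[of j] by (auto simp: PiE_iff)
      qed (use x in \<open>auto simp: space_PiM PiE_iff extensional_def\<close>)
    next
      fix x assume x: "x \<in> Pi\<^sub>E J (\<lambda>j. A (?k j))"
      have "x (h i) \<in> A i" if "i \<in> I" for i using x hJ[OF that] k[OF that] by (auto simp: PiE_iff)
      moreover have "x j \<in> space X" if "j \<in> J" for j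
        using x that sets.sets_into_space[OF A, of "?k j"] k'[OF that] by (auto simp: PiE_iff)
      ultimately show "x \<in> ?T -` Pi\<^sub>E I A \<inter> space (tuples J)"
        using x by (auto simp: space_PiM PiE_iff)
    qed
    moreover have "Pi\<^sub>E I A \<in> sets (tuples I)" using A IJ by (intro sets_PiM_I_finite) auto
    ultimately have "emeasure (distr (tuples J) (tuples I) ?T) (Pi\<^sub>E I A)
        = emeasure (tuples J) (Pi\<^sub>E J (\<lambda>j. A (?k j)))"
      using T by (simp add: emeasure_distr)
    also have "\<dots> = (\<Prod>j\<in>J. emeasure X (A (?k j)))"
      using IJ A k' by (intro prod.emeasure_PiM) auto
    also have "\<dots> = (\<Prod>i\<in>I. emeasure X (A i))"
      by (rule prod.reindex_bij_betw[OF h, symmetric, THEN trans]) (auto simp: k)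
    finally show "emeasure (distr (tuples J) (tuples I) ?T) (Pi\<^sub>E I A) = (\<Prod>i\<in>I. emeasure X (A i))" .
  qed simp
  then have "(\<integral>x. H (x ` I) \<partial>tuples I) = (\<integral>x. H (x ` I) \<partial>distr (tuples J) (tuples I) ?T)" by simp
  also have "\<dots> = (\<integral>x. H (?T x ` I) \<partial>tuples J)" by (rule integral_distr[OF T H])
  also have "\<dots> = (\<integral>x. H (x ` J) \<partial>tuples J)"
  proof (intro Bochner_Integration.integral_cong refl)
    fix x :: "nat \<Rightarrow> 'b"
    have "?T x ` I = (\<lambda>i. x (h i)) ` I" by auto
    also have "\<dots> = x ` J" using h by (auto simp: bij_betw_def image_image[symmetric])
    finally show "H (?T x ` I) = H (x ` J)" by simp
  qed
  finally show ?thesis by simp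
qed

section \<open>Functionals of exponential growth and their moment series\<close>

text \<open>Exponential growth in the number of points is beaten by the factorial in
  \<open>moment\<close> and is stable under products. Measurability is demanded for every finite
  index set because splitting a tuple produces arbitrary subsets of indices.\<close>

definition tame :: "('b set \<Rightarrow> real) \<Rightarrow> bool" where
  "tame H \<longleftrightarrow> (\<forall>I. finite I \<longrightarrow> (\<lambda>x. H (x ` I)) \<in> borel_measurable (tuples I)) \<and>
    (\<exists>c\<ge>0. \<exists>C\<ge>1. \<forall>\<gamma>. finite \<gamma> \<and> \<gamma> \<subseteq> space X \<longrightarrow> \<bar>H \<gamma>\<bar> \<le> c * C ^ card \<gamma>)"

lemma tame_boundE:
  assumes "tame H"
  obtains c C where "c \<ge> 0" "C \<ge> 1"
    "\<And>\<gamma>. finite \<gamma> \<Longrightarrow> \<gamma> \<subseteq> space X \<Longrightarrow> \<bar>H \<gamma>\<bar> \<le> c * C ^ card \<gamma>"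
  using assms unfolding tame_def by metis

lemma tame_measurable: "tame H \<Longrightarrow> finite I \<Longrightarrow> (\<lambda>x. H (x ` I)) \<in> borel_measurable (tuples I)"
  by (simp add: tame_def)

lemma tame_measurable_subset:
  assumes "tame H" "finite I" "A \<subseteq> I"
  shows "(\<lambda>x. H (x ` A)) \<in> borel_measurable (tuples I)"
proof -
  have r: "(\<lambda>x. restrict x A) \<in> tuples I \<rightarrow>\<^sub>M tuples A"
    by (rule measurable_restrict_subset) fact
  have "(\<lambda>x. H (restrict x A ` A)) \<in> borel_measurable (tuples I)"
    by (rule measurable_compose[OF r tame_measurable]) (use assms finite_subset in auto)
  then show ?thesis by simp
qed

lemma image_bound:
  fixes c C :: real
  assumes "c \<ge> 0" "C \<ge> 1"
    and "\<And>\<gamma>. finite \<gamma> \<Longrightarrow> \<gamma> \<subseteq> space X \<Longrightarrow> \<bar>H \<gamma>\<bar> \<le> c * C ^ card \<gamma>"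
    and I: "finite I" "x \<in> space (tuples I)"
  shows "\<bar>H (x ` I)\<bar> \<le> c * C ^ card I"
proof -
  have "\<bar>H (x ` I)\<bar> \<le> c * C ^ card (x ` I)"
    using I space_tuplesD[OF I(2)] by (intro assms(3)) auto
  \<comment> \<open>A non-injective tuple has fewer points than indices; \<open>C \<ge> 1\<close>
    absorbs the difference.\<close>
  also have "\<dots> \<le> c * C ^ card I"
    by (intro mult_left_mono power_increasing card_image_le assms)
  finally show ?thesis .
qed

lemma tame_bound:
  assumes "tame H"
  obtains c C where "c \<ge> 0" "C \<ge> 1"
    "\<And>I x. finite I \<Longrightarrow> x \<in> space (tuples I) \<Longrightarrow> \<bar>H (x ` I)\<bar> \<le> c * C ^ card I"
  by (rule tame_boundE[OF assms]) (metis image_bound)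

lemma measure_tuples: "finite I \<Longrightarrow> measure (tuples I) (space (tuples I)) = measure X (space X) ^ card I"
  unfolding space_PiM measure_def
  by (subst prod.emeasure_PiM) (auto simp: emeasure_eq_measure ennreal_power)

lemma finite_measure_tuples: "finite I \<Longrightarrow> finite_measure (tuples I)"
  unfolding space_PiM
  by (intro finite_measureI, unfold space_PiM, subst prod.emeasure_PiM)
    (auto simp: emeasure_eq_measure ennreal_power)

lemma tame_integrable:
  assumes "tame H" "finite I" "A \<subseteq> I"
  shows "integrable (tuples I) (\<lambda>x. H (x ` A))"
proof -
  interpret T: finite_measure "tuples I" using assms(2) by (rule finite_measure_tuples)
  obtain c C where c: "c \<ge> 0" "C \<ge> 1"
    "\<And>I x. finite I \<Longrightarrow> x \<in> space (tuples I) \<Longrightarrow> \<bar>H (x ` I)\<bar> \<le> c * C ^ card I"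
    by (fact tame_bound[OF assms(1)])
  have "\<bar>H (x ` A)\<bar> \<le> c * C ^ card A" if "x \<in> space (tuples I)" for x
    using c(3)[of A "restrict x A"] that assms finite_subset[OF assms(3)]
    by (auto simp: space_PiM PiE_iff)
  then show ?thesis
    by (intro T.integrable_const_bound[of _ "c * C ^ card A"] AE_I2 tame_measurable_subset[OF assms]) auto
qed

lemma tame_mult: 
  assumes "tame F" "tame G" 
  shows "tame (\<lambda>\<gamma>. F \<gamma> * G \<gamma>)"
proof -
  obtain c C where c: "c \<ge> 0" "C \<ge> 1" "\<And>\<gamma>. finite \<gamma> \<Longrightarrow> \<gamma> \<subseteq> space X \<Longrightarrow> \<bar>F \<gamma>\<bar> \<le> c * C ^ card \<gamma>"
    by (fact tame_boundE[OF assms(1)])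
  obtain d E where d: "d \<ge> 0" "E \<ge> 1" "\<And>\<gamma>. finite \<gamma> \<Longrightarrow> \<gamma> \<subseteq> space X \<Longrightarrow> \<bar>G \<gamma>\<bar> \<le> d * E ^ card \<gamma>"
    by (fact tame_boundE[OF assms(2)])
  have "\<bar>F \<gamma> * G \<gamma>\<bar> \<le> (c * d) * (C * E) ^ card \<gamma>" if "finite \<gamma>" "\<gamma> \<subseteq> space X" for \<gamma>
  proof -
    have "\<bar>F \<gamma> * G \<gamma>\<bar> \<le> (c * C ^ card \<gamma>) * (d * E ^ card \<gamma>)"
      unfolding abs_mult using c d that by (intro mult_mono) auto
    then show ?thesis by (simp add: power_mult_distrib mult_ac)
  qed
  moreover have "c * d \<ge> 0" "C * E \<ge> 1" using c d mult_mono[of 1 C 1 E] by auto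
  ultimately show ?thesis
    using assms unfolding tame_def by (auto intro!: borel_measurable_times)
qed

text \<open>Summed over \<open>n\<close>, this is the integral of \<open>H\<close> against the
  Poisson law with intensity \<open>X\<close>, up to the factor
  \<open>exp (measure X (space X))\<close>.\<close>

definition moment :: "('b set \<Rightarrow> real) \<Rightarrow> nat \<Rightarrow> real" where
  "moment H n = 1 / fact n * (\<integral>x. H (x ` {..<n}) \<partial>tuples {..<n})"

text \<open>Comparison with the exponential series at
  \<open>C * measure X (space X)\<close>.\<close>

lemma summable_moment:
  assumes "tame H"
  shows "summable (\<lambda>n. norm (moment H n))"
proof -
  obtain c C where c: "c \<ge> 0" "C \<ge> 1"
    "\<And>I x. finite I \<Longrightarrow> x \<in> space (tuples I) \<Longrightarrow> \<bar>H (x ` I)\<bar> \<le> c * C ^ card I"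
    by (fact tame_bound[OF assms(1)])
  let ?m = "measure X (space X)"
  have le: "norm (moment H n) \<le> c * ((C * ?m) ^ n / fact n)" for n
  proof -
    interpret T: finite_measure "tuples {..<n}" by (rule finite_measure_tuples) simp
    have "norm (\<integral>x. H (x ` {..<n}) \<partial>tuples {..<n}) \<le> (\<integral>x. norm (H (x ` {..<n})) \<partial>tuples {..<n})"
      by (rule integral_norm_bound)
    also have "\<dots> \<le> (\<integral>x. c * C ^ n \<partial>tuples {..<n})"
    proof (rule integral_mono)
      show "integrable (tuples {..<n}) (\<lambda>x. norm (H (x ` {..<n})))"
        by (intro integrable_norm tame_integrable[OF assms]) auto
      show "norm (H (x ` {..<n})) \<le> c * C ^ n" if "x \<in> space (tuples {..<n})" for x
        using c(3)[OF _ that] by simp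
    qed simp
    also have "\<dots> = c * (C * ?m) ^ n"
      by (simp add: measure_tuples power_mult_distrib)
    finally have "norm (moment H n) \<le> 1 / fact n * (c * (C * ?m) ^ n)"
      unfolding moment_def norm_mult by (intro mult_mono) auto
    then show ?thesis by simp
  qed
  have "summable (\<lambda>n. c * ((C * ?m) ^ n / fact n))"
    using summable_exp[of "C * ?m"] by (intro summable_mult) (simp add: divide_inverse mult.commute)
  then show ?thesis
    by (rule summable_comparison_test'[where N = 0]) (use le in \<open>simp only: real_norm_def abs_idempotent\<close>)
qed

text \<open>Fubini for the product of the coordinates in \<open>A\<close> with those in
  \<open>S - A\<close>; each factor depends on one of the two groups.\<close>

lemma integral_split:
  assumes "tame F" "tame G" "finite S" "A \<subseteq> S"
  shows "integrable (tuples S) (\<lambda>x. F (x ` A) * G (x ` (S - A)))"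
    and "(\<integral>x. F (x ` A) * G (x ` (S - A)) \<partial>tuples S)
      = (\<integral>x. F (x ` A) \<partial>tuples A) * (\<integral>x. G (x ` (S - A)) \<partial>tuples (S - A))"
proof -
  interpret T: finite_measure "tuples S" using assms(3) by (rule finite_measure_tuples)
  have finA: "finite A" using assms finite_subset by blast
  obtain c C where c: "c \<ge> 0" "C \<ge> 1"
    "\<And>I x. finite I \<Longrightarrow> x \<in> space (tuples I) \<Longrightarrow> \<bar>F (x ` I)\<bar> \<le> c * C ^ card I"
    by (fact tame_bound[OF assms(1)])
  have F: "\<bar>F (x ` A)\<bar> \<le> c * C ^ card A" if "x \<in> space (tuples S)" for x
    using c(3)[of A "restrict x A"] that assms finA by (auto simp: space_PiM PiE_iff)
  have "integrable (tuples S) (\<lambda>x. (c * C ^ card A) * G (x ` (S - A)))"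
    using assms by (intro integrable_mult_right tame_integrable) auto
  then show int: "integrable (tuples S) (\<lambda>x. F (x ` A) * G (x ` (S - A)))"
  proof (rule Bochner_Integration.integrable_bound)
    show "(\<lambda>x. F (x ` A) * G (x ` (S - A))) \<in> borel_measurable (tuples S)"
      using assms by (intro borel_measurable_times tame_measurable_subset) auto
    show "AE x in tuples S. norm (F (x ` A) * G (x ` (S - A))) \<le> norm (c * C ^ card A * G (x ` (S - A)))"
      using F c by (intro AE_I2) (auto simp: abs_mult intro!: mult_right_mono)
  qed
  have S: "A \<union> (S - A) = S" using assms by auto
  have "(\<integral>x. F (x ` A) * G (x ` (S - A)) \<partial>tuples S)
    = (\<integral>x. (\<integral>y. F (merge A (S - A) (x, y) ` A) * G (merge A (S - A) (x, y) ` (S - A)) \<partial>tuples (S - A)) \<partial>tuples A)"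
    using prod.product_integral_fold[of A "S - A" "\<lambda>x. F (x ` A) * G (x ` (S - A))"] int finA assms
    unfolding S by simp
  also have "\<dots> = (\<integral>x. (\<integral>y. F (x ` A) * G (y ` (S - A)) \<partial>tuples (S - A)) \<partial>tuples A)"
  proof -
    have "merge A (S - A) (x, y) ` A = x ` A" "merge A (S - A) (x, y) ` (S - A) = y ` (S - A)"
      for x y :: "nat \<Rightarrow> 'b"
      by (auto simp: merge_def intro!: image_cong)
    then show ?thesis by simp
  qed
  also have "\<dots> = (\<integral>x. F (x ` A) \<partial>tuples A) * (\<integral>x. G (x ` (S - A)) \<partial>tuples (S - A))"
    by simp
  finally show "(\<integral>x. F (x ` A) * G (x ` (S - A)) \<partial>tuples S)
      = (\<integral>x. F (x ` A) \<partial>tuples A) * (\<integral>x. G (x ` (S - A)) \<partial>tuples (S - A))" .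
qed

text \<open>The factor \<open>n! / (i! (n - i)!)\<close> hidden in a Cauchy product counts the index
  sets \<open>A\<close> of size \<open>i\<close>, and the integrals depend on \<open>A\<close> only
  through its size. The convolution is therefore one integral over \<open>n\<close>-tuples of a sum
  over all splittings.\<close>

lemma moment_convolution:
  assumes "tame F" "tame G"
  shows "(\<Sum>i\<le>n. moment F i * moment G (n - i))
    = 1 / fact n * (\<integral>x. (\<Sum>A\<in>Pow {..<n}. F (x ` A) * G (x ` ({..<n} - A))) \<partial>tuples {..<n})"
proof -
  define a where "a i = (\<integral>x. F (x ` {..<i}) \<partial>tuples {..<i})" for i
  define b where "b i = (\<integral>x. G (x ` {..<i}) \<partial>tuples {..<i})" for i
  have a: "(\<integral>x. F (x ` A) \<partial>tuples A) = a (card A)" if "A \<subseteq> {..<n}" for A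
    unfolding a_def using that finite_subset[OF that]
    by (intro integral_tuples_card tame_measurable assms) auto
  have b: "(\<integral>x. G (x ` A) \<partial>tuples A) = b (card A)" if "A \<subseteq> {..<n}" for A
    unfolding b_def using that finite_subset[OF that]
    by (intro integral_tuples_card tame_measurable assms) auto
  have "(\<integral>x. (\<Sum>A\<in>Pow {..<n}. F (x ` A) * G (x ` ({..<n} - A))) \<partial>tuples {..<n})
    = (\<Sum>A\<in>Pow {..<n}. (\<integral>x. F (x ` A) \<partial>tuples A) * (\<integral>x. G (x ` ({..<n} - A)) \<partial>tuples ({..<n} - A)))"
    using integral_split[OF assms] by (subst Bochner_Integration.integral_sum) auto
  also have "\<dots> = (\<Sum>A\<in>Pow {..<n}. a (card A) * b (n - card A))"
    by (intro sum.cong refl) (auto simp: a b card_Diff_subset finite_subset)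
  also have "\<dots> = (\<Sum>i\<le>n. \<Sum>A\<in>{A \<in> Pow {..<n}. card A = i}. a (card A) * b (n - card A))"
    using card_mono[of "{..<n}"] by (intro sum.group[symmetric]) fastforce+
  also have "\<dots> = (\<Sum>i\<le>n. real (n choose i) * (a i * b (n - i)))"
    by (intro sum.cong refl) (simp add: n_subsets[of "{..<n}", simplified])
  also have "\<dots> = fact n * (\<Sum>i\<le>n. moment F i * moment G (n - i))"
    unfolding sum_distrib_left
    by (intro sum.cong refl) (simp add: moment_def a_def b_def binomial_fact field_simps)
  finally show ?thesis by simp
qed

text \<open>Both sides are Cauchy products. Their terms of order \<open>n\<close> are compared under
  the integral by \<open>fkg_complementary\<close>, applied to the point set of almost every
  tuple.\<close>

theorem moment_correlation:
  assumes tame: "tame W" "tame f" "tame g"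
    and W0: "\<And>\<gamma>. finite \<gamma> \<Longrightarrow> \<gamma> \<subseteq> space X \<Longrightarrow> W \<gamma> \<ge> 0"
    and f0: "\<And>\<gamma>. finite \<gamma> \<Longrightarrow> \<gamma> \<subseteq> space X \<Longrightarrow> f \<gamma> \<ge> 0"
    and g0: "\<And>\<gamma>. finite \<gamma> \<Longrightarrow> \<gamma> \<subseteq> space X \<Longrightarrow> g \<gamma> \<ge> 0"
    and W: "\<And>A B. finite A \<Longrightarrow> finite B \<Longrightarrow> A \<subseteq> space X \<Longrightarrow> B \<subseteq> space X
      \<Longrightarrow> W A * W B \<le> W (twist_join P A B) * W (twist_meet P A B)"
    and f: "\<And>A B. finite A \<Longrightarrow> finite B \<Longrightarrow> A \<subseteq> space X \<Longrightarrow> B \<subseteq> space X \<Longrightarrow> twisted_le P A B \<Longrightarrow> f A \<le> f B"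
    and g: "\<And>A B. finite A \<Longrightarrow> finite B \<Longrightarrow> A \<subseteq> space X \<Longrightarrow> B \<subseteq> space X \<Longrightarrow> twisted_le P A B \<Longrightarrow> g A \<le> g B"
  shows "(\<Sum>n. moment (\<lambda>\<gamma>. f \<gamma> * W \<gamma>) n) * (\<Sum>n. moment (\<lambda>\<gamma>. g \<gamma> * W \<gamma>) n)
    \<le> (\<Sum>n. moment (\<lambda>\<gamma>. f \<gamma> * g \<gamma> * W \<gamma>) n) * (\<Sum>n. moment W n)"
proof -
  note fW = tame_mult[OF tame(2,1)] and gW = tame_mult[OF tame(3,1)]
    and fgW = tame_mult[OF tame_mult[OF tame(2,3)] tame(1)]
  note lhs = Cauchy_product_sums[OF summable_moment[OF fW] summable_moment[OF gW]]
  note rhs = Cauchy_product_sums[OF summable_moment[OF fgW] summable_moment[OF tame(1)]]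
  show ?thesis
  proof (rule sums_le[OF _ lhs rhs])
    fix n
    let ?S = "{..<n} :: nat set"
    have "(\<integral>x. (\<Sum>A\<in>Pow ?S. f (x ` A) * W (x ` A) * (g (x ` (?S - A)) * W (x ` (?S - A)))) \<partial>tuples ?S)
      \<le> (\<integral>x. (\<Sum>A\<in>Pow ?S. f (x ` A) * g (x ` A) * W (x ` A) * W (x ` (?S - A))) \<partial>tuples ?S)"
    proof (rule integral_mono_AE)
      show "integrable (tuples ?S) (\<lambda>x. \<Sum>A\<in>Pow ?S. f (x ` A) * W (x ` A) * (g (x ` (?S - A)) * W (x ` (?S - A))))"
        using integral_split(1)[OF fW gW] by (intro Bochner_Integration.integrable_sum) auto
      show "integrable (tuples ?S) (\<lambda>x. \<Sum>A\<in>Pow ?S. f (x ` A) * g (x ` A) * W (x ` A) * W (x ` (?S - A)))"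
        using integral_split(1)[OF fgW tame(1)] by (intro Bochner_Integration.integrable_sum) auto
      show "AE x in tuples ?S. (\<Sum>A\<in>Pow ?S. f (x ` A) * W (x ` A) * (g (x ` (?S - A)) * W (x ` (?S - A))))
        \<le> (\<Sum>A\<in>Pow ?S. f (x ` A) * g (x ` A) * W (x ` A) * W (x ` (?S - A)))"
        using AE_injective[OF finite_lessThan[of n]] AE_space
      proof eventually_elim
        case (elim x)
        \<comment> \<open>For an injective tuple, splittings of the index set are the same as
          splittings of the point set.\<close>
        have reindex: "(\<Sum>A\<in>Pow ?S. h (x ` A) (x ` (?S - A))) = (\<Sum>\<Gamma>\<in>Pow (x ` ?S). h \<Gamma> (x ` ?S - \<Gamma>))"
          for h :: "'b set \<Rightarrow> 'b set \<Rightarrow> real"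
        proof (rule sum.reindex_cong[OF inj_on_image_Pow[OF elim(1)] , symmetric])
          show "Pow (x ` ?S) = (`) x ` Pow ?S" by (rule image_Pow_surj[symmetric]) simp
          show "h (x ` A) (x ` ?S - x ` A) = h (x ` A) (x ` (?S - A))" if "A \<in> Pow ?S" for A
            using that elim(1) by (simp add: inj_on_image_set_diff[of x ?S])
        qed
        have sub: "finite \<Gamma>" "\<Gamma> \<subseteq> space X" if "\<Gamma> \<subseteq> x ` ?S" for \<Gamma>
          using that space_tuplesD[OF elim(2)] finite_subset[OF that] by auto
        show ?case
          unfolding reindex[of "\<lambda>A B. f A * W A * (g B * W B)"] reindex[of "\<lambda>A B. f A * g A * W A * W B"]
          by (rule fkg_complementary[where P = P]) (use sub in \<open>blast intro: W0 f0 g0 W f g\<close>)+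
      qed
    qed
    then show "(\<Sum>i\<le>n. moment (\<lambda>\<gamma>. f \<gamma> * W \<gamma>) i * moment (\<lambda>\<gamma>. g \<gamma> * W \<gamma>) (n - i))
      \<le> (\<Sum>i\<le>n. moment (\<lambda>\<gamma>. f \<gamma> * g \<gamma> * W \<gamma>) i * moment W (n - i))"
      unfolding moment_convolution[OF fW gW] moment_convolution[OF fgW tame(1)]
      by (intro mult_left_mono) auto
  qed
qed

end

section \<open>The weight of a configuration\<close>

lemma UNIV_color: "(UNIV :: color set) = {Red, Blue}"
  using color.exhaust by auto

lemma opposite_neq [simp]: "opposite c \<noteq> c" "c \<noteq> opposite c"
  by (cases c; simp)+

lemma opposite_inject [simp]: "opposite c = opposite c' \<longleftrightarrow> c = c'"
  by (cases c; cases c'; simp)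

text \<open>Total boundedness at the radii \<open>1 / (n + 1)\<close>: \<open>Q\<close> consists of
  all the centres, which are not claimed to lie in \<open>D\<close>. This countability is what makes
  the distance jointly measurable.\<close>

lemma compact_countable_dense:
  fixes D :: "'a::metric_space set"
  assumes "compact D"
  obtains Q where "countable Q" "\<And>x e. x \<in> D \<Longrightarrow> e > 0 \<Longrightarrow> \<exists>q\<in>Q. dist q x < e"
proof -
  have "\<exists>k. finite k \<and> D \<subseteq> (\<Union>x\<in>k. ball x (inverse (Suc n)))" for n
    using assms unfolding compact_eq_totally_bounded by auto
  then obtain k where k: "finite (k n)" "D \<subseteq> (\<Union>x\<in>k n. ball x (inverse (Suc n)))" for n
    by metis
  show ?thesis
  proof (rule that[of "\<Union>n. k n"])
    show "countable (\<Union>n. k n)" using k(1) by (auto intro: countable_finite)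
    fix x e assume "x \<in> D" "(e::real) > 0"
    then obtain n where n: "inverse (Suc n) < e" using reals_Archimedean by blast
    obtain q where "q \<in> k n" "dist q x < inverse (Suc n)" using k(2)[of n] \<open>x \<in> D\<close> by auto
    then show "\<exists>q\<in>\<Union>n. k n. dist q x < e" using n by force
  qed
qed

section \<open>The coloured space: null points and measurable distances\<close>

locale fifm =
  fixes D :: "'a::metric_space set" and \<Lambda> :: "'a measure" and \<mu> :: real
  assumes compact: "compact D" and radon: "radon_on D \<Lambda>" and diffuse: "non_atomic \<Lambda>"
    and \<mu>: "\<mu> > 0"
begin

abbreviation "X \<equiv> colored_measure \<Lambda>"

lemma sets_\<Lambda>: "sets \<Lambda> = sets (restrict_space borel D)"
  using radon by (simp add: radon_on_def)

lemma space_\<Lambda>: "space \<Lambda> = D"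
  using sets_eq_imp_space_eq[OF sets_\<Lambda>] by (simp add: space_restrict_space)

lemma Int_in_sets: "A \<in> sets borel \<Longrightarrow> A \<inter> D \<in> sets \<Lambda>"
  unfolding sets_\<Lambda> by (auto simp: sets_restrict_space)

lemma borel_in_sets: "A \<in> sets borel \<Longrightarrow> A \<subseteq> D \<Longrightarrow> A \<in> sets \<Lambda>"
  using Int_in_sets[of A] by (simp add: Int_absorb2)

lemma finite_\<Lambda>: "finite_measure \<Lambda>"
proof (rule finite_measureI)
  have "emeasure \<Lambda> D < \<infinity>" using radon compact unfolding radon_on_def by blast
  then show "emeasure \<Lambda> (space \<Lambda>) \<noteq> \<infinity>" by (simp add: space_\<Lambda>)
qed

text \<open>A point of positive mass would be an atom, its only subsets being the empty set and
  itself.\<close>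

lemma \<Lambda>_singleton:
  assumes "p \<in> D"
  shows "emeasure \<Lambda> {p} = 0"
proof (rule ccontr)
  assume "emeasure \<Lambda> {p} \<noteq> 0"
  then have "emeasure \<Lambda> {p} > 0" by (simp add: zero_less_iff_neq_zero)
  moreover have "{p} \<in> sets \<Lambda>" using assms by (intro borel_in_sets) auto
  moreover have "emeasure \<Lambda> B = 0 \<or> emeasure \<Lambda> ({p} - B) = 0" if "B \<subseteq> {p}" for B
  proof -
    have "B = {} \<or> B = {p}" using that by blast
    then show ?thesis by auto
  qed
  ultimately show False using diffuse unfolding non_atomic_def by blast
qed

lemma sets_X: "sets X = sets (\<Lambda> \<Otimes>\<^sub>M count_space UNIV)"
  and space_X: "space X = D \<times> UNIV"
  by (simp_all add: colored_measure_def space_pair_measure space_\<Lambda>)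

lemma finite_X: "finite_measure X"
  unfolding colored_measure_def using finite_\<Lambda>
  by (intro finite_measure_pair_measure finite_measure_count_space) (simp_all add: UNIV_color)

lemma Times_in_sets: "B \<in> sets borel \<Longrightarrow> B \<subseteq> D \<Longrightarrow> B \<times> C \<in> sets X"
  unfolding sets_X by (intro pair_measureI borel_in_sets) auto

lemma X_singleton:
  assumes "y \<in> space X"
  shows "emeasure X {y} = 0"
proof -
  interpret sigma_finite_measure "count_space UNIV :: color measure"
    by (rule sigma_finite_measure_count_space_finite) (simp add: UNIV_color)
  have "emeasure X {y} = emeasure X ({fst y} \<times> {snd y})" by simp
  also have "\<dots> = emeasure \<Lambda> {fst y} * emeasure (count_space UNIV) {snd y}"
    unfolding colored_measure_def using assms
    by (intro emeasure_pair_measure_Times borel_in_sets) (auto simp: space_X)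
  also have "\<dots> = 0" using assms by (auto simp: \<Lambda>_singleton space_X)
  finally show ?thesis .
qed

text \<open>The event \<open>dist x y < a\<close> is a countable union of products of one-variable
  events: for some \<open>q\<close> in a countable set and some rational \<open>s\<close>, both
  \<open>dist q x < s\<close> and \<open>dist q y < a - s\<close>.\<close>

lemma dist_measurable: "(\<lambda>z. dist (fst z) (snd z)) \<in> borel_measurable (\<Lambda> \<Otimes>\<^sub>M \<Lambda>)"
  unfolding borel_measurable_iff_less
proof
  fix a :: real
  obtain Q where Q: "countable Q" "\<And>x e. x \<in> D \<Longrightarrow> e > 0 \<Longrightarrow> \<exists>q\<in>Q. dist q x < e"
    using compact_countable_dense[OF compact] by blast
  have near: "dist x y < a \<longleftrightarrow> (\<exists>q\<in>Q. \<exists>s\<in>\<rat>. dist q x < s \<and> dist q y < a - s)"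
    if x: "x \<in> D" for x y
  proof
    assume "dist x y < a"
    \<comment> \<open>Half of the slack is needed because \<open>dist q x\<close> enters twice, once
      itself and once in the bound for \<open>dist q y\<close>.\<close>
    then obtain q where q: "q \<in> Q" "dist q x < (a - dist x y) / 2"
      using Q(2)[OF x, of "(a - dist x y) / 2"] by auto
    have "dist q y \<le> dist q x + dist x y" by (rule dist_triangle)
    then have "dist q x < a - dist q y" using q by simp
    then obtain s where "s \<in> \<rat>" "dist q x < s" "s < a - dist q y"
      using Rats_dense_in_real by blast
    then show "\<exists>q\<in>Q. \<exists>s\<in>\<rat>. dist q x < s \<and> dist q y < a - s" using q by force
  next
    assume "\<exists>q\<in>Q. \<exists>s\<in>\<rat>. dist q x < s \<and> dist q y < a - s"
    then obtain q s where "dist q x < s" "dist q y < a - s" by blast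
    then show "dist x y < a" using dist_triangle[of x y q] by (simp add: dist_commute)
  qed
  have m: "(\<lambda>x. dist q x) \<in> borel_measurable \<Lambda>" for q
    unfolding measurable_cong_sets[OF sets_\<Lambda> refl]
    by (intro borel_measurable_continuous_on_restrict continuous_intros)
  have m1: "(\<lambda>z. dist q (fst z)) \<in> borel_measurable (\<Lambda> \<Otimes>\<^sub>M \<Lambda>)"
    and m2: "(\<lambda>z. dist q (snd z)) \<in> borel_measurable (\<Lambda> \<Otimes>\<^sub>M \<Lambda>)" for q
    using measurable_compose[OF measurable_fst m] measurable_compose[OF measurable_snd m] by auto
  have "{z \<in> space (\<Lambda> \<Otimes>\<^sub>M \<Lambda>). dist (fst z) (snd z) < a} =
    {z \<in> space (\<Lambda> \<Otimes>\<^sub>M \<Lambda>). \<exists>q\<in>Q. \<exists>s\<in>\<rat>. dist q (fst z) < s \<and> dist q (snd z) < a - s}"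
    by (intro Collect_cong conj_cong refl near) (auto simp: space_pair_measure space_\<Lambda>)
  also have "\<dots> \<in> sets (\<Lambda> \<Otimes>\<^sub>M \<Lambda>)"
    using m1 m2 Q(1)
    by (intro sets.sets_Collect_countable_Ex' sets.sets_Collect_conj countable_rat borel_measurable_less) auto
  finally show "{z \<in> space (\<Lambda> \<Otimes>\<^sub>M \<Lambda>). dist (fst z) (snd z) < a} \<in> sets (\<Lambda> \<Otimes>\<^sub>M \<Lambda>)" .
qed

lemma position_measurable: "fst \<in> X \<rightarrow>\<^sub>M \<Lambda>" and color_measurable: "snd \<in> X \<rightarrow>\<^sub>M count_space UNIV"
  unfolding colored_measure_def by measurable

lemma dist_positions_measurable: "(\<lambda>z. dist (fst (fst z)) (fst (snd z))) \<in> borel_measurable (X \<Otimes>\<^sub>M X)"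
proof -
  have "(\<lambda>z. (fst (fst z), fst (snd z))) \<in> X \<Otimes>\<^sub>M X \<rightarrow>\<^sub>M \<Lambda> \<Otimes>\<^sub>M \<Lambda>"
    by (intro measurable_Pair measurable_compose[OF measurable_fst position_measurable]
        measurable_compose[OF measurable_snd position_measurable])
  from measurable_compose[OF this dist_measurable] show ?thesis by simp
qed

lemma color_relation_sets: "{z \<in> space (X \<Otimes>\<^sub>M X). R (snd (fst z)) (snd (snd z))} \<in> sets (X \<Otimes>\<^sub>M X)"
proof -
  have eq: "{z \<in> space (X \<Otimes>\<^sub>M X). snd (fst z) = c \<and> snd (snd z) = c'} \<in> sets (X \<Otimes>\<^sub>M X)" for c c'
  proof -
    have m: "(\<lambda>z. snd (fst z)) \<in> X \<Otimes>\<^sub>M X \<rightarrow>\<^sub>M count_space UNIV"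
      "(\<lambda>z. snd (snd z)) \<in> X \<Otimes>\<^sub>M X \<rightarrow>\<^sub>M count_space UNIV"
      by (intro measurable_compose[OF measurable_fst color_measurable]
        measurable_compose[OF measurable_snd color_measurable])+
    have "(\<lambda>z. snd (fst z)) -` {c} \<inter> space (X \<Otimes>\<^sub>M X) \<inter> ((\<lambda>z. snd (snd z)) -` {c'} \<inter> space (X \<Otimes>\<^sub>M X))
        \<in> sets (X \<Otimes>\<^sub>M X)"
      by (intro sets.Int measurable_sets[OF m(1)] measurable_sets[OF m(2)]) auto
    also have "(\<lambda>z. snd (fst z)) -` {c} \<inter> space (X \<Otimes>\<^sub>M X) \<inter> ((\<lambda>z. snd (snd z)) -` {c'} \<inter> space (X \<Otimes>\<^sub>M X))
        = {z \<in> space (X \<Otimes>\<^sub>M X). snd (fst z) = c \<and> snd (snd z) = c'}"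
      by auto
    finally show ?thesis .
  qed
  have "{z \<in> space (X \<Otimes>\<^sub>M X). R (snd (fst z)) (snd (snd z))}
      = (\<Union>cc\<in>{cc \<in> UNIV \<times> UNIV. R (fst cc) (snd cc)}.
          {z \<in> space (X \<Otimes>\<^sub>M X). snd (fst z) = fst cc \<and> snd (snd z) = snd cc})"
    by auto
  also have "\<dots> \<in> sets (X \<Otimes>\<^sub>M X)"
  proof (rule sets.finite_UN)
    show "finite {cc \<in> UNIV \<times> (UNIV :: color set). R (fst cc) (snd cc)}"
      by (rule finite_subset[of _ "UNIV \<times> UNIV"]) (auto simp: UNIV_color)
  qed (rule eq)
  finally show ?thesis .
qed

text \<open>The diagonal is the event that the positions have distance zero and the colours
  agree.\<close>

sublocale diffuse_space X
proof -
  interpret finite_measure X by (rule finite_X)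
  show "diffuse_space X"
  proof
    have "{z \<in> space (X \<Otimes>\<^sub>M X). fst z = snd z} = {z \<in> space (X \<Otimes>\<^sub>M X).
      dist (fst (fst z)) (fst (snd z)) = 0 \<and> snd (fst z) = snd (snd z)}"
      by (auto simp: prod_eq_iff)
    also have "\<dots> \<in> sets (X \<Otimes>\<^sub>M X)"
      using dist_positions_measurable
      by (intro sets.sets_Collect_conj color_relation_sets borel_measurable_eq) auto
    finally show "{z \<in> space (X \<Otimes>\<^sub>M X). fst z = snd z} \<in> sets (X \<Otimes>\<^sub>M X)" .
  qed (rule X_singleton)
qed

section \<open>Neighbourhoods, removal rates and order weights\<close>

lemma nbhd_eq: "nbhd D x = (ball (fst x) 1 \<inter> D) \<times> {opposite (snd x)}"
  by (auto simp: nbhd_def)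

lemma nbhd_relation_sets: "{z \<in> space (X \<Otimes>\<^sub>M X). snd z \<in> nbhd D (fst z)} \<in> sets (X \<Otimes>\<^sub>M X)"
proof -
  have "{z \<in> space (X \<Otimes>\<^sub>M X). snd z \<in> nbhd D (fst z)} = {z \<in> space (X \<Otimes>\<^sub>M X).
      dist (fst (fst z)) (fst (snd z)) < 1 \<and> snd (snd z) = opposite (snd (fst z))}"
    by (auto simp: nbhd_eq space_pair_measure space_X)
  also have "\<dots> \<in> sets (X \<Otimes>\<^sub>M X)"
    using dist_positions_measurable
    by (intro sets.sets_Collect_conj borel_measurable_less
      color_relation_sets[of "\<lambda>c c'. c' = opposite c"]) auto
  finally show ?thesis .
qed

lemma nbhds_in_sets: "finite A \<Longrightarrow> nbhds D A \<in> sets X"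
  unfolding nbhds_def nbhd_eq
  by (intro sets.finite_UN Times_in_sets) (auto simp: compact_imp_closed[OF compact] intro!: sets.Int borel_closed)

abbreviation coverage :: "('a \<times> color) set \<Rightarrow> real" where
  "coverage A \<equiv> measure X (nbhds D A)"

text \<open>The total rate at which the configuration \<open>A\<close> loses particles: an arrival
  in \<open>nbhds D A\<close> is matched, and each present particle leaves at rate
  \<open>\<mu>\<close>.\<close>

definition rate :: "('a \<times> color) set \<Rightarrow> real" where
  "rate A = coverage A + real (card A) * \<mu>"

text \<open>The density without its validity factor, so that the recursion holds for every nonempty
  finite set.\<close>

definition order_weight :: "('a \<times> color) set \<Rightarrow> real" where
  "order_weight A = (\<Sum>xs\<in>permutations_of_set A. \<Prod>i=1..length xs.
     inverse (coverage (set (take i xs)) + real i * \<mu>))"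

abbreviation weight :: "('a \<times> color) set \<Rightarrow> real" where
  "weight \<equiv> unnormalized_density D \<Lambda> \<mu>"

lemma weight_eq: "weight A = (if valid D A then order_weight A else 0)"
  by (simp add: unnormalized_density_def order_weight_def)

text \<open>Neighbourhoods commute with unions, while a neighbour of \<open>A \<inter> B\<close> is
  a common neighbour of \<open>A\<close> and \<open>B\<close>; the rest is inclusion-exclusion for
  measures.\<close>

lemma coverage_Un:
  assumes "finite A" "finite B"
  shows "coverage (A \<union> B) + coverage (A \<inter> B) \<le> coverage A + coverage B"
proof -
  have sets: "nbhds D A \<in> sets X" "nbhds D B \<in> sets X" using assms nbhds_in_sets by auto
  have "nbhds D (A \<union> B) = nbhds D A \<union> nbhds D B" by (auto simp: nbhds_def)
  then have "coverage (A \<union> B) = coverage A + coverage B - measure X (nbhds D A \<inter> nbhds D B)"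
    using finite_measure_Union'[OF sets] finite_measure_Diff'[OF sets(2,1)] by (simp add: Int_commute)
  moreover have "coverage (A \<inter> B) \<le> measure X (nbhds D A \<inter> nbhds D B)"
    using sets by (intro finite_measure_mono) (auto simp: nbhds_def)
  ultimately show ?thesis by simp
qed

text \<open>Points of different colours have neighbours of different colours, hence disjoint
  neighbourhoods.\<close>

lemma coverage_color_split:
  assumes "finite A"
  shows "coverage A = coverage (A \<inter> {y. snd y = c}) + coverage (A - {y. snd y = c})"
proof -
  have "nbhds D A = nbhds D (A \<inter> {y. snd y = c}) \<union> nbhds D (A - {y. snd y = c})"
    by (auto simp: nbhds_def)
  moreover have "nbhds D (A \<inter> {y. snd y = c}) \<inter> nbhds D (A - {y. snd y = c}) = {}"
    by (auto simp: nbhds_def nbhd_def)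
  ultimately show ?thesis
    using assms by (simp add: finite_measure_Union nbhds_in_sets)
qed

text \<open>On one colour the twisted operations are union and intersection, on the other they are
  exchanged. Submodularity is symmetric under this exchange, so the inequalities for the two colours
  add up; the cardinality term is modular.\<close>

lemma rate_submodular:
  fixes c :: color
  assumes fin: "finite A" "finite B"
  defines "P \<equiv> {y. snd y = c}"
  shows "rate (twist_join P A B) + rate (twist_meet P A B) \<le> rate A + rate B"
proof -
  let ?J = "twist_join P A B" and ?M = "twist_meet P A B"
  have finJM: "finite ?J" "finite ?M" using fin by (auto simp: twist_join_def twist_meet_def)
  have parts: "?J \<inter> P = (A \<inter> P) \<union> (B \<inter> P)" "?J - P = (A - P) \<inter> (B - P)"
    "?M \<inter> P = (A \<inter> P) \<inter> (B \<inter> P)" "?M - P = (A - P) \<union> (B - P)"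
    by (auto simp: twist_join_def twist_meet_def)
  have "coverage ?J + coverage ?M \<le> coverage A + coverage B"
    using coverage_Un[of "A \<inter> P" "B \<inter> P"] coverage_Un[of "A - P" "B - P"] fin
      coverage_color_split[OF finJM(1), of c] coverage_color_split[OF finJM(2), of c]
      coverage_color_split[OF fin(1), of c] coverage_color_split[OF fin(2), of c]
    unfolding P_def[symmetric] parts by simp
  moreover have "card ?J + card ?M = card A + card B"
  proof -
    have split: "card S = card (S \<inter> P) + card (S - P)" if "finite S" for S :: "('a \<times> color) set"
      using card_Int_Diff[OF that] .
    show ?thesis
      using card_Un_Int[of "A \<inter> P" "B \<inter> P"] card_Un_Int[of "A - P" "B - P"] fin
      unfolding split[OF finJM(1)] split[OF finJM(2)] split[OF fin(1)] split[OF fin(2)] parts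
      by simp
  qed
  then have "real (card ?J) * \<mu> + real (card ?M) * \<mu> = real (card A) * \<mu> + real (card B) * \<mu>"
    by (metis distrib_right of_nat_add)
  ultimately show ?thesis by (simp add: rate_def)
qed

lemma rate_empty: "rate {} = 0"
  by (simp add: rate_def nbhds_def)

lemma rate_lower: "real (card A) * \<mu> \<le> rate A"
  by (simp add: rate_def)

lemma rate_pos: "finite A \<Longrightarrow> A \<noteq> {} \<Longrightarrow> rate A > 0"
  using rate_lower[of A] \<mu> by (smt (verit) card_gt_0_iff mult_pos_pos of_nat_0_less_iff)

lemma order_weight_empty: "order_weight {} = 1"
  by (simp add: order_weight_def)

lemma order_weight_nonneg: "order_weight A \<ge> 0"
  unfolding order_weight_def using \<mu> by (intro sum_nonneg prod_nonneg) auto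

text \<open>Peel off the last point of the ordering.\<close>

lemma order_weight_rec:
  assumes fin: "finite A" "A \<noteq> {}"
  shows "rate A * order_weight A = (\<Sum>x\<in>A. order_weight (A - {x}))"
proof -
  define h where "h xs = (\<Prod>i=1..length xs. inverse (coverage (set (take i xs)) + real i * \<mu>))"
    for xs :: "('a \<times> color) list"
  \<comment> \<open>The final factor belongs to the full set \<open>A\<close>, reached at length
    \<open>card A\<close>; the shorter prefixes do not contain \<open>x\<close>.\<close>
  have step: "h (ys @ [x]) = inverse (rate A) * h ys"
    if "x \<in> A" "ys \<in> permutations_of_set (A - {x})" for x ys
  proof -
    have "Suc (length ys) = card A"
      using length_finite_permutations_of_set[OF that(2)] card_Suc_Diff1[OF fin(1) that(1)] by simp
    moreover have "set (ys @ [x]) = A"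
      using permutations_of_setD(1)[OF that(2)] that(1) by auto
    ultimately have *: "inverse (coverage (set (ys @ [x])) + real (Suc (length ys)) * \<mu>) = inverse (rate A)"
      by (simp only: rate_def)
    have "h (ys @ [x]) = (\<Prod>i=1..length ys. inverse (coverage (set (take i (ys @ [x]))) + real i * \<mu>))
        * inverse (coverage (set (ys @ [x])) + real (Suc (length ys)) * \<mu>)"
      by (simp add: h_def)
    also have "(\<Prod>i=1..length ys. inverse (coverage (set (take i (ys @ [x]))) + real i * \<mu>)) = h ys"
      unfolding h_def by (intro prod.cong refl) simp
    finally show ?thesis unfolding * by (simp only: mult.commute)
  qed
  have bij: "bij_betw (\<lambda>(x, ys). ys @ [x]) (SIGMA x:A. permutations_of_set (A - {x})) (permutations_of_set A)"
  proof (rule bij_betw_byWitness[where f' = "\<lambda>xs. (last xs, butlast xs)"])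
    have last: "\<exists>ys x. xs = ys @ [x] \<and> x \<in> A \<and> ys \<in> permutations_of_set (A - {x})"
      if "xs \<in> permutations_of_set A" for xs
      using that fin(2) by (cases xs rule: rev_cases) (force simp: permutations_of_set_def)+
    show "\<forall>xs\<in>permutations_of_set A. (case (last xs, butlast xs) of (x, ys) \<Rightarrow> ys @ [x]) = xs"
      "(\<lambda>xs. (last xs, butlast xs)) ` permutations_of_set A \<subseteq> (SIGMA x:A. permutations_of_set (A - {x}))"
      using last by fastforce+
    show "(\<lambda>(x, ys). ys @ [x]) ` (SIGMA x:A. permutations_of_set (A - {x})) \<subseteq> permutations_of_set A"
    proof clarify
      fix x ys assume "x \<in> A" "ys \<in> permutations_of_set (A - {x})"
      then show "ys @ [x] \<in> permutations_of_set A"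
        unfolding permutations_of_set_def mem_Collect_eq by auto
    qed
  qed simp
  have "order_weight A = sum h (permutations_of_set A)" by (simp add: order_weight_def h_def)
  also have "\<dots> = (\<Sum>(x, ys)\<in>(SIGMA x:A. permutations_of_set (A - {x})). h (ys @ [x]))"
    using sum.reindex_bij_betw[OF bij, of h] by (simp add: case_prod_unfold)
  also have "\<dots> = (\<Sum>x\<in>A. \<Sum>ys\<in>permutations_of_set (A - {x}). h (ys @ [x]))"
    using fin by (subst sum.Sigma) auto
  also have "\<dots> = (\<Sum>x\<in>A. \<Sum>ys\<in>permutations_of_set (A - {x}). inverse (rate A) * h ys)"
    using step by (intro sum.cong refl) auto
  also have "\<dots> = inverse (rate A) * (\<Sum>x\<in>A. order_weight (A - {x}))"
    by (simp add: order_weight_def h_def sum_distrib_left)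
  finally show ?thesis using rate_pos[OF fin] by simp
qed

text \<open>Induction through the recursion: its \<open>card A\<close> summands cancel the factor
  \<open>card A\<close> in the lower bound \<open>card A * \<mu>\<close> for the rate.\<close>

lemma order_weight_bound:
  assumes "finite A"
  shows "order_weight A \<le> inverse \<mu> ^ card A"
  using assms
proof (induction A rule: finite_psubset_induct)
  case (psubset A)
  show ?case
  proof (cases "A = {}")
    case False
    have card: "card A > 0" using psubset.hyps False by (simp add: card_gt_0_iff)
    have "real (card A) * \<mu> * order_weight A \<le> rate A * order_weight A"
      by (intro mult_right_mono rate_lower order_weight_nonneg)
    also have "\<dots> = (\<Sum>x\<in>A. order_weight (A - {x}))"
      by (rule order_weight_rec) (use psubset.hyps False in auto)
    also have "\<dots> \<le> (\<Sum>x\<in>A. inverse \<mu> ^ (card A - 1))"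
    proof (rule sum_mono)
      fix x assume "x \<in> A"
      then show "order_weight (A - {x}) \<le> inverse \<mu> ^ (card A - 1)"
        using psubset.IH[of "A - {x}"] psubset.hyps by (metis Diff_subset card_Diff_singleton
            insert_Diff insert_absorb psubsetI singletonI DiffD2)
    qed
    also have "\<dots> = real (card A) * \<mu> * inverse \<mu> ^ card A"
      using card \<mu> by (cases "card A") auto
    finally show ?thesis using card \<mu> by (simp add: mult_le_cancel_left_pos)
  qed (simp add: order_weight_empty)
qed

lemma valid_iff: "valid D A \<longleftrightarrow> finite A \<and> A \<subseteq> D \<times> UNIV \<and> (\<forall>x\<in>A. \<forall>y\<in>A. y \<notin> nbhd D x)"
  by (auto simp: valid_def nbhds_def)

text \<open>Neighbours have opposite colours. Of two points of opposite colours in the join or in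
  the meet, one lies in \<open>A \<inter> B\<close>, so both lie in \<open>A\<close> or both lie in
  \<open>B\<close>, where validity is known.\<close>

lemma valid_twist:
  fixes c :: color
  assumes AB: "valid D A" "valid D B"
  defines "P \<equiv> {y. snd y = c}"
  shows "valid D (twist_join P A B)" "valid D (twist_meet P A B)"
proof -
  have mixed: "y \<notin> nbhd D x"
    if "x \<in> A \<and> y \<in> A \<or> x \<in> B \<and> y \<in> B \<or> (x \<in> P \<longleftrightarrow> y \<in> P)" for x y
    using that
  proof (elim disjE)
    assume "x \<in> P \<longleftrightarrow> y \<in> P"
    then have "snd y \<noteq> opposite (snd x)"
      unfolding P_def mem_Collect_eq by (cases "snd x"; cases "snd y"; cases c) auto
    then show ?thesis by (simp add: nbhd_def)
  qed (use AB in \<open>auto simp: valid_iff\<close>)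
  show "valid D (twist_join P A B)"
    unfolding valid_iff
  proof (intro conjI ballI)
    fix x y assume "x \<in> twist_join P A B" "y \<in> twist_join P A B"
    then show "y \<notin> nbhd D x" by (intro mixed) (unfold twist_join_def, blast)
  qed (use AB in \<open>auto simp: valid_iff twist_join_def\<close>)
  show "valid D (twist_meet P A B)"
    unfolding valid_iff
  proof (intro conjI ballI)
    fix x y assume "x \<in> twist_meet P A B" "y \<in> twist_meet P A B"
    then show "y \<notin> nbhd D x" by (intro mixed) (unfold twist_meet_def, blast)
  qed (use AB in \<open>auto simp: valid_iff twist_meet_def\<close>)
qed

lemma weight_nonneg: "weight A \<ge> 0"
  by (simp add: weight_eq order_weight_nonneg)

text \<open>If \<open>A\<close> or \<open>B\<close> is invalid the left side vanishes; otherwise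
  validity passes to join and meet, and the inequality is that for
  \<open>order_weight\<close>.\<close>

lemma weight_log_supermodular:
  assumes "finite A" "finite B"
  shows "weight A * weight B
    \<le> weight (twist_join {y. snd y = c} A B) * weight (twist_meet {y. snd y = c} A B)"
proof (cases "valid D A \<and> valid D B")
  case True
  then show ?thesis
    using log_supermodular_of_recursion[of rate order_weight "{y. snd y = c}" A B] assms
      rate_pos order_weight_empty order_weight_rec rate_empty rate_submodular[of _ _ c]
      valid_twist[of A B c]
    by (simp add: weight_eq)
next
  case False
  then have "weight A * weight B = 0" by (auto simp: weight_eq)
  also have "\<dots> \<le> weight (twist_join {y. snd y = c} A B) * weight (twist_meet {y. snd y = c} A B)"
    by (intro mult_nonneg_nonneg weight_nonneg)
  finally show ?thesis .
qed

section \<open>Measurability and growth of the weight\<close>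

lemma nbhd_pair_sets:
  assumes "i \<in> I"
  shows "{z \<in> space (tuples I \<Otimes>\<^sub>M X). snd z \<in> nbhd D (fst z i)} \<in> sets (tuples I \<Otimes>\<^sub>M X)"
proof -
  have m: "(\<lambda>z. (fst z i, snd z)) \<in> tuples I \<Otimes>\<^sub>M X \<rightarrow>\<^sub>M X \<Otimes>\<^sub>M X"
    using assms by (intro measurable_Pair measurable_snd
        measurable_compose[OF measurable_fst measurable_component_singleton])
  have "{z \<in> space (tuples I \<Otimes>\<^sub>M X). snd z \<in> nbhd D (fst z i)}
    = (\<lambda>z. (fst z i, snd z)) -` {z \<in> space (X \<Otimes>\<^sub>M X). snd z \<in> nbhd D (fst z)}
        \<inter> space (tuples I \<Otimes>\<^sub>M X)"
    using measurable_space[OF m] by auto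
  then show ?thesis using measurable_sets[OF m nbhd_relation_sets] by simp
qed

text \<open>The coverage is the measure of a section of a measurable set in the product of the
  tuples with \<open>X\<close>.\<close>

lemma coverage_measurable:
  assumes "finite I"
  shows "(\<lambda>x. coverage (x ` I)) \<in> borel_measurable (tuples I)"
proof -
  let ?Q = "{z \<in> space (tuples I \<Otimes>\<^sub>M X). \<exists>i\<in>I. snd z \<in> nbhd D (fst z i)}"
  have Q: "?Q \<in> sets (tuples I \<Otimes>\<^sub>M X)"
    using assms nbhd_pair_sets by (intro sets.sets_Collect_finite_Ex) auto
  have "coverage (x ` I) = enn2real (emeasure X (Pair x -` ?Q))" if "x \<in> space (tuples I)" for x
  proof -
    have "Pair x -` ?Q = nbhds D (x ` I)"
      using that by (auto simp: nbhds_def nbhd_def space_pair_measure space_X)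
    then show ?thesis by (simp add: measure_def)
  qed
  moreover have "(\<lambda>x. enn2real (emeasure X (Pair x -` ?Q))) \<in> borel_measurable (tuples I)"
    using measurable_emeasure_Pair[OF Q] by (rule borel_measurable_enn2real)
  ultimately show ?thesis by (subst measurable_cong) auto
qed

lemma valid_measurable:
  assumes "finite I"
  shows "(\<lambda>x. if valid D (x ` I) then 1 else 0 :: real) \<in> borel_measurable (tuples I)"
proof -
  have close: "{x \<in> space (tuples I). x j \<in> nbhd D (x i)} \<in> sets (tuples I)" if ij: "i \<in> I" "j \<in> I" for i j
  proof -
    have m: "(\<lambda>x. (x i, x j)) \<in> tuples I \<rightarrow>\<^sub>M X \<Otimes>\<^sub>M X"
      using ij by (intro measurable_Pair measurable_component_singleton)
    have "{x \<in> space (tuples I). x j \<in> nbhd D (x i)}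
      = (\<lambda>x. (x i, x j)) -` {z \<in> space (X \<Otimes>\<^sub>M X). snd z \<in> nbhd D (fst z)} \<inter> space (tuples I)"
      using measurable_space[OF m] by auto
    then show ?thesis using measurable_sets[OF m nbhd_relation_sets] by simp
  qed
  have "{x \<in> space (tuples I). valid D (x ` I)}
    = {x \<in> space (tuples I). \<forall>i\<in>I. \<forall>j\<in>I. \<not> x j \<in> nbhd D (x i)}"
    using assms space_tuplesD[of _ I] unfolding valid_iff space_X by blast
  also have "\<dots> \<in> sets (tuples I)"
    using assms close by (intro sets.sets_Collect_finite_All sets.sets_Collect_neg) auto
  finally show ?thesis by (intro measurable_If) auto
qed

text \<open>A sum over orderings of the image is not visibly a measurable function of the tuple; on
  injective tuples the recursion expresses it through \<open>coverage\<close> and smaller index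
  sets.\<close>

lemma order_weight_measurable:
  assumes "finite I"
  shows "(\<lambda>x. order_weight (x ` I)) \<in> borel_measurable (tuples I)"
  using assms
proof (rule measurable_image_induct)
  fix I :: "nat set"
  assume I: "finite I" and IH: "\<And>i. i \<in> I \<Longrightarrow> (\<lambda>x. order_weight (x ` (I - {i}))) \<in> borel_measurable (tuples (I - {i}))"
  \<comment> \<open>For empty \<open>I\<close> the recursive formula would give \<open>0\<close>,
    being an empty sum, whereas the empty configuration has weight \<open>1\<close>.\<close>
  let ?g = "\<lambda>x. if I = {} then 1 else
    inverse (coverage (x ` I) + real (card I) * \<mu>) * (\<Sum>i\<in>I. order_weight (x ` (I - {i})))"
  have "(\<lambda>x. order_weight (x ` (I - {i}))) \<in> borel_measurable (tuples I)" if "i \<in> I" for i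
  proof -
    have r: "(\<lambda>x. restrict x (I - {i})) \<in> tuples I \<rightarrow>\<^sub>M tuples (I - {i})"
      by (rule measurable_restrict_subset) auto
    have "(\<lambda>x. order_weight (restrict x (I - {i}) ` (I - {i}))) \<in> borel_measurable (tuples I)"
      by (rule measurable_compose[OF r IH[OF that]])
    then show ?thesis by simp
  qed
  then have "?g \<in> borel_measurable (tuples I)"
    using coverage_measurable[OF I] by (cases "I = {}") simp_all
  then show "\<exists>g\<in>borel_measurable (tuples I). \<forall>x\<in>space (tuples I). inj_on x I \<longrightarrow> order_weight (x ` I) = g x"
  proof (rule bexI[rotated], intro ballI impI)
    fix x :: "nat \<Rightarrow> 'a \<times> color" assume inj: "inj_on x I"
    show "order_weight (x ` I) = ?g x"
    proof (cases "I = {}")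
      case False
      have "(\<Sum>y\<in>x ` I. order_weight (x ` I - {y})) = (\<Sum>i\<in>I. order_weight (x ` (I - {i})))"
      proof (subst sum.reindex[OF inj], intro sum.cong refl)
        fix i assume "i \<in> I"
        then have "x ` I - {x i} = x ` (I - {i})"
          using inj_on_image_set_diff[OF inj, of I "{i}"] by simp
        then show "((\<lambda>y. order_weight (x ` I - {y})) \<circ> x) i = order_weight (x ` (I - {i}))" by simp
      qed
      then have "rate (x ` I) * order_weight (x ` I) = (\<Sum>i\<in>I. order_weight (x ` (I - {i})))"
        using order_weight_rec[of "x ` I"] I False by simp
      moreover have "rate (x ` I) = coverage (x ` I) + real (card I) * \<mu>"
        by (simp add: rate_def card_image[OF inj])
      moreover have "rate (x ` I) \<noteq> 0" using rate_pos[of "x ` I"] I False by simp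
      then have "order_weight (x ` I) = inverse (rate (x ` I)) * (rate (x ` I) * order_weight (x ` I))"
        by simp
      ultimately show ?thesis using False by simp
    qed (simp add: order_weight_empty)
  qed
qed

lemma tame_weight: "tame weight"
proof -
  have "(\<lambda>x. weight (x ` I)) \<in> borel_measurable (tuples I)" if "finite I" for I
  proof -
    have "weight A = order_weight A * (if valid D A then 1 else 0)" for A
      by (simp add: weight_eq)
    then show ?thesis
      using order_weight_measurable[OF that] valid_measurable[OF that] by (simp only: borel_measurable_times)
  qed
  \<comment> \<open>The maximum with \<open>1\<close> meets the demand \<open>C \<ge> 1\<close> in
    \<open>tame\<close>.\<close>
  moreover have "\<bar>weight A\<bar> \<le> 1 * max 1 (inverse \<mu>) ^ card A" if "finite A" for A
  proof -
    have "\<bar>weight A\<bar> \<le> order_weight A"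
      using order_weight_nonneg[of A] by (simp add: weight_eq)
    also have "\<dots> \<le> inverse \<mu> ^ card A" by (rule order_weight_bound[OF that])
    also have "\<dots> \<le> max 1 (inverse \<mu>) ^ card A"
      using \<mu> by (intro power_mono) auto
    finally show ?thesis by simp
  qed
  moreover have "max 1 (inverse \<mu>) \<ge> 1" by simp
  ultimately show ?thesis unfolding tame_def by (metis zero_le_one)
qed

section \<open>Counts on the space of configurations\<close>

abbreviation "configs \<equiv> finite_configurations X"

lemma space_configs: "space configs = {\<gamma>. finite \<gamma> \<and> \<gamma> \<subseteq> space X}"
  unfolding finite_configurations_def by (rule space_measure_of) auto

definition count :: "('a \<times> color) set \<Rightarrow> ('a \<times> color) set \<Rightarrow> real" where
  "count A \<gamma> = real (card (\<gamma> \<inter> A))"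

lemma count_measurable:
  assumes A: "A \<in> sets X"
  shows "count A \<in> borel_measurable configs"
proof -
  have "(\<lambda>\<gamma>. card (\<gamma> \<inter> A)) \<in> configs \<rightarrow>\<^sub>M count_space UNIV"
    unfolding measurable_count_space_eq2_countable
  proof (intro conjI ballI)
    fix n :: nat
    have "(\<lambda>\<gamma>. card (\<gamma> \<inter> A)) -` {n} \<inter> space configs
        = {\<gamma>. finite \<gamma> \<and> \<gamma> \<subseteq> space X \<and> card (\<gamma> \<inter> A) = n}"
      by (auto simp: space_configs)
    also have "\<dots> \<in> sets configs"
      unfolding finite_configurations_def using A
      by (subst sets_measure_of) (auto intro!: sigma_sets.Basic)
    finally show "(\<lambda>\<gamma>. card (\<gamma> \<inter> A)) -` {n} \<inter> space configs \<in> sets configs" .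
  qed auto
  then have "(\<lambda>\<gamma>. real (card (\<gamma> \<inter> A))) \<in> borel_measurable configs" by measurable
  then show ?thesis by (simp add: count_def[abs_def])
qed

text \<open>Summing indicators over indices counts repeated entries several times, so this formula
  serves injective tuples and \<open>measurable_image_induct\<close> handles the others.\<close>

lemma count_image_measurable:
  assumes A: "A \<in> sets X" and "finite I"
  shows "(\<lambda>x. count A (x ` I)) \<in> borel_measurable (tuples I)"
  using \<open>finite I\<close>
proof (rule measurable_image_induct)
  fix I :: "nat set" assume I: "finite I"
  have "count A (x ` I) = (\<Sum>i\<in>I. indicator A (x i))" if "inj_on x I" for x
  proof -
    have "x ` I \<inter> A = x ` {i \<in> I. x i \<in> A}" by auto
    then have "card (x ` I \<inter> A) = card {i \<in> I. x i \<in> A}"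
      using card_image[OF inj_on_subset[OF that, of "{i \<in> I. x i \<in> A}"]] by auto
    then show ?thesis
      using I by (simp add: count_def indicator_def sum.If_cases Int_def)
  qed
  moreover have "(\<lambda>x. \<Sum>i\<in>I. indicator A (x i) :: real) \<in> borel_measurable (tuples I)"
    using A by (intro borel_measurable_sum
      measurable_compose[OF measurable_component_singleton borel_measurable_indicator]) auto
  ultimately show "\<exists>g\<in>borel_measurable (tuples I).
      \<forall>x\<in>space (tuples I). inj_on x I \<longrightarrow> count A (x ` I) = g x"
    by (intro bexI[rotated]) auto
qed

text \<open>Counting events generate \<open>configs\<close>, so measurability of counts suffices.
  Every measurable statistic then becomes a measurable function of the tuple.\<close>

lemma image_measurable:
  assumes "finite I"
  shows "(\<lambda>x. x ` I) \<in> tuples I \<rightarrow>\<^sub>M configs"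
  unfolding finite_configurations_def
proof (rule measurable_measure_of)
  show "(\<lambda>x. x ` I) \<in> space (tuples I) \<rightarrow> {\<gamma>. finite \<gamma> \<and> \<gamma> \<subseteq> space X}"
    using assms space_tuplesD[of _ I] by auto
  fix S assume "S \<in> {{\<gamma>. finite \<gamma> \<and> \<gamma> \<subseteq> space X \<and> card (\<gamma> \<inter> A) = n} | A n. A \<in> sets X}"
  then obtain A n where A: "A \<in> sets X"
    and S: "S = {\<gamma>. finite \<gamma> \<and> \<gamma> \<subseteq> space X \<and> card (\<gamma> \<inter> A) = n}" by auto
  have "(\<lambda>x. x ` I) -` S \<inter> space (tuples I) = {x \<in> space (tuples I). count A (x ` I) = real n}"
    using assms space_tuplesD[of _ I] unfolding S count_def by auto
  also have "\<dots> \<in> sets (tuples I)"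
    using count_image_measurable[OF A assms] by (intro borel_measurable_eq) auto
  finally show "(\<lambda>x. x ` I) -` S \<inter> space (tuples I) \<in> sets (tuples I)" .
qed auto

lemma tame_bounded:
  assumes f: "f \<in> borel_measurable configs" and b: "\<And>\<gamma>. \<gamma> \<in> space configs \<Longrightarrow> \<bar>f \<gamma>\<bar> \<le> b"
  shows "tame f"
proof -
  have "\<bar>f \<gamma>\<bar> \<le> max 0 b * 1 ^ card \<gamma>" if "finite \<gamma>" "\<gamma> \<subseteq> space X" for \<gamma>
    using b[of \<gamma>] that by (simp add: space_configs)
  moreover have "max 0 b \<ge> 0" "(1::real) \<ge> 1" by auto
  moreover have "(\<lambda>x. f (x ` I)) \<in> borel_measurable (tuples I)" if "finite I" for I
    using measurable_compose[OF image_measurable[OF that] f] .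
  ultimately show ?thesis unfolding tame_def by metis
qed

text \<open>Powers of the cardinality grow at most exponentially, by \<open>n < 2 ^ n\<close>. This
  gives finite moments of the total number of points.\<close>

lemma tame_count_power: "tame (\<lambda>\<gamma>. count (space X) \<gamma> ^ k)"
proof -
  have "(\<lambda>x. count (space X) (x ` I) ^ k) \<in> borel_measurable (tuples I)" if "finite I" for I
    using count_image_measurable[OF _ that, of "space X"] by (intro borel_measurable_power) auto
  moreover have "\<bar>count (space X) \<gamma> ^ k\<bar> \<le> 1 * (2 ^ k) ^ card \<gamma>" if "finite \<gamma>" "\<gamma> \<subseteq> space X" for \<gamma>
  proof -
    have "count (space X) \<gamma> \<le> 2 ^ card \<gamma>"
      using that of_nat_less_two_power[of "card \<gamma>", where 'a = real] by (simp add: count_def Int_absorb2)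
    then have "count (space X) \<gamma> ^ k \<le> (2 ^ card \<gamma>) ^ k"
      by (intro power_mono) (auto simp: count_def)
    then show ?thesis by (simp add: count_def power_mult[symmetric] mult.commute)
  qed
  moreover have "(2::real) ^ k \<ge> 1" by simp
  ultimately show ?thesis unfolding tame_def by (metis zero_le_one)
qed

text \<open>An entry equal to \<open>y\<close> confines the tuple to a box with a null factor, so
  almost no tuple meets \<open>y\<close>.\<close>

lemma moment_count_null:
  assumes y: "y \<in> space X"
  shows "moment (\<lambda>\<gamma>. count {y} \<gamma> * weight \<gamma>) n = 0"
proof -
  have "AE x in tuples {..<n}. x i \<noteq> y" if "i < n" for i
  proof (rule AE_I)
    let ?N = "Pi\<^sub>E {..<n} (\<lambda>j. if j = i then {y} else space X)"
    show "{x \<in> space (tuples {..<n}). \<not> x i \<noteq> y} \<subseteq> ?N"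
      by (simp add: subset_eq space_PiM PiE_iff)
    show "?N \<in> sets (tuples {..<n})"
      using y by (intro sets_PiM_I_finite) (auto simp: singleton_sets)
    have "emeasure (tuples {..<n}) ?N = (\<Prod>j<n. emeasure X (if j = i then {y} else space X))"
      using y by (intro prod.emeasure_PiM) (auto simp: singleton_sets)
    also have "\<dots> = 0" using that X_singleton[OF y] by (intro prod_zero bexI[of _ i]) auto
    finally show "emeasure (tuples {..<n}) ?N = 0" .
  qed
  then have "AE x in tuples {..<n}. \<forall>i\<in>{..<n}. x i \<noteq> y"
    by (intro AE_finite_allI) auto
  then have "AE x in tuples {..<n}. count {y} (x ` {..<n}) * weight (x ` {..<n}) = 0"
  proof eventually_elim
    case (elim x)
    then have "x ` {..<n} \<inter> {y} = {}" by auto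
    then show ?case by (simp only: count_def card.empty of_nat_0 mult_zero_left)
  qed
  then show ?thesis by (simp add: moment_def integral_eq_zero_AE)
qed

end

section \<open>Correlations under the law of the matching process\<close>

lemma card_points_of_color: "card (points_of_color c \<gamma> \<inter> B) = card (\<gamma> \<inter> B \<times> {c})"
proof -
  have "(\<lambda>p. (p, c)) ` (points_of_color c \<gamma> \<inter> B) = \<gamma> \<inter> B \<times> {c}"
    by (auto simp: points_of_color_def)
  then show ?thesis by (metis card_image inj_on_def prod.inject)
qed

locale fifm_law = fifm D \<Lambda> \<mu> + M: prob_space M
  for D :: "'a::metric_space set" and \<Lambda> :: "'a measure" and \<mu> :: real and M :: "'w measure" +
  fixes \<eta> :: "'w \<Rightarrow> ('a \<times> color) set"
  assumes \<eta>: "\<eta> \<in> measurable M (finite_configurations (colored_measure \<Lambda>))"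
    and law: "has_fifm_law D \<Lambda> \<mu> M \<eta>"
begin

section \<open>Means as normalized moment series\<close>

abbreviation "K \<equiv> normalizing_const D \<Lambda> \<mu>"

definition expect :: "(('a \<times> color) set \<Rightarrow> real) \<Rightarrow> real" where
  "expect f = (\<integral>\<omega>. f (\<eta> \<omega>) \<partial>M)"

text \<open>The test functions for which \<open>has_fifm_law\<close> prescribes the mean.\<close>

definition bounded_statistic :: "(('a \<times> color) set \<Rightarrow> real) \<Rightarrow> bool" where
  "bounded_statistic f \<longleftrightarrow> f \<in> borel_measurable configs \<and> (\<exists>b. \<forall>\<gamma>\<in>space configs. \<bar>f \<gamma>\<bar> \<le> b)"

lemma bounded_statisticI:
  "f \<in> borel_measurable configs \<Longrightarrow> (\<And>\<gamma>. \<gamma> \<in> space configs \<Longrightarrow> \<bar>f \<gamma>\<bar> \<le> b) \<Longrightarrow> bounded_statistic f"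
  unfolding bounded_statistic_def by blast

lemma bounded_statistic_tame: "bounded_statistic f \<Longrightarrow> tame f"
  unfolding bounded_statistic_def using tame_bounded by blast

lemma \<eta>_space: "\<omega> \<in> space M \<Longrightarrow> \<eta> \<omega> \<in> space configs"
  using measurable_space[OF \<eta>] .

lemma \<eta>_measurable: "f \<in> borel_measurable configs \<Longrightarrow> (\<lambda>\<omega>. f (\<eta> \<omega>)) \<in> borel_measurable M"
  using measurable_compose[OF \<eta>] .

lemma bounded_statistic_integrable:
  assumes "bounded_statistic f"
  shows "integrable M (\<lambda>\<omega>. f (\<eta> \<omega>))"
proof -
  obtain b where b: "\<forall>\<gamma>\<in>space configs. \<bar>f \<gamma>\<bar> \<le> b" and f: "f \<in> borel_measurable configs"
    using assms unfolding bounded_statistic_def by blast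
  show ?thesis
    using b \<eta>_space by (intro M.integrable_const_bound[of _ b] AE_I2 \<eta>_measurable[OF f]) auto
qed

lemma expect_eq:
  assumes f: "bounded_statistic f"
  shows "expect f = K * (\<Sum>n. moment (\<lambda>\<gamma>. f \<gamma> * weight \<gamma>) n)"
proof -
  have "(\<lambda>n. 1 / fact n * (\<integral>x. f (x ` {..<n}) * janossy_density D \<Lambda> \<mu> (x ` {..<n}) \<partial>tuples {..<n}))
      sums expect f"
    using law f unfolding has_fifm_law_def bounded_statistic_def expect_def by blast
  moreover have "1 / fact n * (\<integral>x. f (x ` {..<n}) * janossy_density D \<Lambda> \<mu> (x ` {..<n}) \<partial>tuples {..<n})
      = K * moment (\<lambda>\<gamma>. f \<gamma> * weight \<gamma>) n" for n
    unfolding janossy_density_def moment_def mult.left_commute[of _ K] by simp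
  ultimately have "(\<lambda>n. K * moment (\<lambda>\<gamma>. f \<gamma> * weight \<gamma>) n) sums expect f" by simp
  moreover have "summable (moment (\<lambda>\<gamma>. f \<gamma> * weight \<gamma>))"
    by (rule summable_norm_cancel[OF summable_moment[OF tame_mult[OF bounded_statistic_tame[OF f] tame_weight]]])
  ultimately show ?thesis
    using sums_unique2[OF _ sums_mult[OF summable_sums]] by blast
qed

text \<open>Testing the law on the constant \<open>1\<close> gives the normalization, and with it
  that the series does not vanish.\<close>

lemma K_total: "K * (\<Sum>n. moment weight n) = 1"
proof -
  have "bounded_statistic (\<lambda>_. 1)" by (rule bounded_statisticI[of _ 1]) auto
  from expect_eq[OF this] show ?thesis by (simp add: expect_def M.prob_space)
qed

lemma moment_mono:
  assumes "tame F" "tame G" "\<And>\<gamma>. \<gamma> \<in> space configs \<Longrightarrow> F \<gamma> \<le> G \<gamma>"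
  shows "moment F n \<le> moment G n"
  unfolding moment_def
proof (intro mult_left_mono integral_mono tame_integrable assms)
  fix x assume "x \<in> space (tuples {..<n})"
  then show "x ` {..<n} \<in> space configs"
    using measurable_space[OF image_measurable[OF finite_lessThan[of n]]] by blast
qed auto

text \<open>The product of \<open>K\<close> with a nonnegative series is \<open>1\<close>, which
  excludes \<open>K \<le> 0\<close>.\<close>

lemma K_pos: "K > 0"
proof -
  have "moment weight n \<ge> 0" for n
    unfolding moment_def by (intro mult_nonneg_nonneg integral_nonneg_AE AE_I2 weight_nonneg) auto
  then have "(\<Sum>n. moment weight n) \<ge> 0"
    by (intro suminf_nonneg summable_norm_cancel[OF summable_moment[OF tame_weight]])
  then show ?thesis using K_total by (metis less_le mult_nonpos_nonneg not_one_le_zero linorder_not_le)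
qed

section \<open>Positive correlation of increasing statistics\<close>

text \<open>The colour \<open>c\<close> keeps the inclusion order and the other colour has it
  reversed. Nonnegativity is included so that products stay increasing.\<close>

definition increasing_statistic :: "color \<Rightarrow> (('a \<times> color) set \<Rightarrow> real) \<Rightarrow> bool" where
  "increasing_statistic c f \<longleftrightarrow> bounded_statistic f \<and> (\<forall>\<gamma>\<in>space configs. f \<gamma> \<ge> 0) \<and>
    (\<forall>A\<in>space configs. \<forall>B\<in>space configs. twisted_le {y. snd y = c} A B \<longrightarrow> f A \<le> f B)"

lemma increasing_statistic_mult:
  assumes f: "increasing_statistic c f" and g: "increasing_statistic c g"
  shows "increasing_statistic c (\<lambda>\<gamma>. f \<gamma> * g \<gamma>)"
proof -
  obtain a b where ab: "\<forall>\<gamma>\<in>space configs. \<bar>f \<gamma>\<bar> \<le> a" "\<forall>\<gamma>\<in>space configs. \<bar>g \<gamma>\<bar> \<le> b"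
    and m: "f \<in> borel_measurable configs" "g \<in> borel_measurable configs"
    using f g unfolding increasing_statistic_def bounded_statistic_def by blast
  have "\<bar>f \<gamma> * g \<gamma>\<bar> \<le> a * b" if "\<gamma> \<in> space configs" for \<gamma>
    unfolding abs_mult using ab that by (intro mult_mono) force+
  then have "bounded_statistic (\<lambda>\<gamma>. f \<gamma> * g \<gamma>)"
    using m by (intro bounded_statisticI borel_measurable_times)
  then show ?thesis
    using f g unfolding increasing_statistic_def by (auto intro!: mult_mono)
qed

text \<open>Multiplying \<open>moment_correlation\<close> by \<open>K * K\<close> turns its series
  into means, and the series of \<open>weight\<close> into \<open>1\<close>.\<close>

lemma expect_mult:
  assumes f: "increasing_statistic c f" and g: "increasing_statistic c g"
  shows "expect f * expect g \<le> expect (\<lambda>\<gamma>. f \<gamma> * g \<gamma>)"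
proof -
  have b: "bounded_statistic f" "bounded_statistic g" "bounded_statistic (\<lambda>\<gamma>. f \<gamma> * g \<gamma>)"
    using f g increasing_statistic_mult[OF f g] by (auto simp: increasing_statistic_def)
  have "(\<Sum>n. moment (\<lambda>\<gamma>. f \<gamma> * weight \<gamma>) n) * (\<Sum>n. moment (\<lambda>\<gamma>. g \<gamma> * weight \<gamma>) n)
    \<le> (\<Sum>n. moment (\<lambda>\<gamma>. f \<gamma> * g \<gamma> * weight \<gamma>) n) * (\<Sum>n. moment weight n)"
  proof (rule moment_correlation[where P = "{y. snd y = c}"])
    show "weight A * weight B \<le> weight (twist_join {y. snd y = c} A B) * weight (twist_meet {y. snd y = c} A B)"
      if "finite A" "finite B" for A B
      using that by (rule weight_log_supermodular)
  qed (use f g in \<open>auto simp: increasing_statistic_def space_configs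
      intro: tame_weight bounded_statistic_tame weight_nonneg\<close>)
  from mult_left_mono[OF this, of "K * K"] K_pos
  have "expect f * expect g \<le> expect (\<lambda>\<gamma>. f \<gamma> * g \<gamma>) * (K * (\<Sum>n. moment weight n))"
    unfolding expect_eq[OF b(1)] expect_eq[OF b(2)] expect_eq[OF b(3)] by (simp add: mult_ac)
  then show ?thesis unfolding K_total by simp
qed

lemma expect_prod:
  assumes "finite I" "\<And>i. i \<in> I \<Longrightarrow> increasing_statistic c (f i)"
  shows "increasing_statistic c (\<lambda>\<gamma>. \<Prod>i\<in>I. f i \<gamma>)"
    and "(\<Prod>i\<in>I. expect (f i)) \<le> expect (\<lambda>\<gamma>. \<Prod>i\<in>I. f i \<gamma>)"
proof -
  \<comment> \<open>Both claims go through one induction, because \<open>expect_mult\<close> needs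
    the partial product to be increasing.\<close>
  have "increasing_statistic c (\<lambda>\<gamma>. \<Prod>i\<in>I. f i \<gamma>) \<and> (\<Prod>i\<in>I. expect (f i)) \<le> expect (\<lambda>\<gamma>. \<Prod>i\<in>I. f i \<gamma>)"
    using assms
  proof (induction I rule: finite_induct)
    case empty
    have "bounded_statistic (\<lambda>_. 1)" by (rule bounded_statisticI[of _ 1]) auto
    then show ?case by (simp add: increasing_statistic_def expect_def M.prob_space)
  next
    case (insert i I)
    have inc: "increasing_statistic c (f i)" "increasing_statistic c (\<lambda>\<gamma>. \<Prod>i\<in>I. f i \<gamma>)"
      and le: "(\<Prod>i\<in>I. expect (f i)) \<le> expect (\<lambda>\<gamma>. \<Prod>i\<in>I. f i \<gamma>)"
      using insert.IH insert.prems by auto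
    have "expect (f i) \<ge> 0"
      unfolding expect_def using inc(1) \<eta>_space
      by (intro integral_nonneg_AE AE_I2) (auto simp: increasing_statistic_def)
    then have "expect (f i) * (\<Prod>i\<in>I. expect (f i)) \<le> expect (f i) * expect (\<lambda>\<gamma>. \<Prod>i\<in>I. f i \<gamma>)"
      using le by (rule mult_left_mono[rotated])
    also have "\<dots> \<le> expect (\<lambda>\<gamma>. f i \<gamma> * (\<Prod>i\<in>I. f i \<gamma>))"
      by (rule expect_mult[OF inc])
    finally show ?case
      using increasing_statistic_mult[OF inc] insert.hyps by simp
  qed
  then show "increasing_statistic c (\<lambda>\<gamma>. \<Prod>i\<in>I. f i \<gamma>)"
    "(\<Prod>i\<in>I. expect (f i)) \<le> expect (\<lambda>\<gamma>. \<Prod>i\<in>I. f i \<gamma>)" by auto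
qed

section \<open>Integrability of counts and the product inequality\<close>

lemma count_nonneg: "count A \<gamma> \<ge> 0"
  by (simp add: count_def)

lemma count_mono: "A \<subseteq> B \<Longrightarrow> \<gamma> \<in> space configs \<Longrightarrow> count A \<gamma> \<le> count B \<gamma>"
  unfolding count_def space_configs by (auto intro!: card_mono)

lemma count_le_total: "\<gamma> \<in> space configs \<Longrightarrow> count A \<gamma> \<le> count (space X) \<gamma>"
  unfolding count_def space_configs by (auto intro!: card_mono)

text \<open>The law speaks of bounded statistics only. Truncations at \<open>m\<close> have means
  bounded uniformly by the convergent series of the untruncated power, and monotone convergence
  removes the truncation.\<close>

lemma integrable_total_power: "integrable M (\<lambda>\<omega>. count (space X) (\<eta> \<omega>) ^ k)"
proof -
  define T where "T \<gamma> = count (space X) \<gamma> ^ k" for \<gamma>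
  have T: "T \<in> borel_measurable configs"
    unfolding T_def by (intro borel_measurable_power count_measurable) auto
  have T0: "T \<gamma> \<ge> 0" for \<gamma> by (simp add: T_def count_nonneg)
  define f where "f m \<gamma> = min (T \<gamma>) (real m)" for m \<gamma>
  have f: "bounded_statistic (f m)" for m
    using T T0 by (intro bounded_statisticI[of _ "real m"]) (auto simp: f_def[abs_def])
  have tT: "tame (\<lambda>\<gamma>. T \<gamma> * weight \<gamma>)"
    using tame_mult[OF tame_count_power tame_weight] unfolding T_def .
  have tf: "tame (\<lambda>\<gamma>. f m \<gamma> * weight \<gamma>)" for m
    by (intro tame_mult bounded_statistic_tame f tame_weight)
  have bound: "expect (f m) \<le> K * (\<Sum>n. moment (\<lambda>\<gamma>. T \<gamma> * weight \<gamma>) n)" for m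
    unfolding expect_eq[OF f]
  proof (intro mult_left_mono suminf_le moment_mono tf tT)
    show "f m \<gamma> * weight \<gamma> \<le> T \<gamma> * weight \<gamma>" for \<gamma>
      by (intro mult_right_mono weight_nonneg) (simp add: f_def)
    show "summable (moment (\<lambda>\<gamma>. f m \<gamma> * weight \<gamma>))" "summable (moment (\<lambda>\<gamma>. T \<gamma> * weight \<gamma>))"
      using summable_norm_cancel[OF summable_moment] tf tT by auto
    show "0 \<le> K" using K_pos by simp
  qed
  have "incseq (\<lambda>m. expect (f m))"
    unfolding expect_def
    by (intro monoI integral_mono bounded_statistic_integrable f) (auto simp: f_def)
  then obtain L where L: "(\<lambda>m. expect (f m)) \<longlonglongrightarrow> L"
    using incseq_convergent[of "\<lambda>m. expect (f m)"] bound by metis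
  have "integrable M (\<lambda>\<omega>. T (\<eta> \<omega>))"
  proof (rule integrable_monotone_convergence[where f = "\<lambda>m \<omega>. f m (\<eta> \<omega>)" and x = L])
    show "AE \<omega> in M. mono (\<lambda>m. f m (\<eta> \<omega>))"
      by (intro AE_I2 monoI) (auto simp: f_def)
    show "AE \<omega> in M. (\<lambda>m. f m (\<eta> \<omega>)) \<longlonglongrightarrow> T (\<eta> \<omega>)"
    proof (intro AE_I2 tendsto_eventually)
      fix \<omega>
      obtain N where N: "T (\<eta> \<omega>) \<le> real N" using real_arch_simple by blast
      show "\<forall>\<^sub>F m in sequentially. f m (\<eta> \<omega>) = T (\<eta> \<omega>)"
        using eventually_ge_at_top[of N]
      proof eventually_elim
        case (elim m)
        then have "T (\<eta> \<omega>) \<le> real m" using N by linarith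
        then show ?case by (simp add: f_def)
      qed
    qed
  qed (use L bounded_statistic_integrable[OF f] \<eta>_measurable[OF T] in \<open>auto simp: expect_def\<close>)
  then show ?thesis by (simp add: T_def)
qed

text \<open>Dominated by a power of the total number of points.\<close>

lemma integrable_prod_count:
  assumes "finite I" and A: "\<And>i. i \<in> I \<Longrightarrow> A i \<in> sets X"
  shows "integrable M (\<lambda>\<omega>. \<Prod>i\<in>I. count (A i) (\<eta> \<omega>))"
proof (rule Bochner_Integration.integrable_bound[OF integrable_total_power[of "card I"]])
  show "(\<lambda>\<omega>. \<Prod>i\<in>I. count (A i) (\<eta> \<omega>)) \<in> borel_measurable M"
    using A by (intro borel_measurable_prod \<eta>_measurable count_measurable)
  show "AE \<omega> in M. norm (\<Prod>i\<in>I. count (A i) (\<eta> \<omega>)) \<le> norm (count (space X) (\<eta> \<omega>) ^ card I)"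
  proof (rule AE_I2)
    fix \<omega> assume \<omega>: "\<omega> \<in> space M"
    have "(\<Prod>i\<in>I. count (A i) (\<eta> \<omega>)) \<le> (\<Prod>i\<in>I. count (space X) (\<eta> \<omega>))"
      using count_le_total[OF \<eta>_space[OF \<omega>]] count_nonneg by (intro prod_mono) auto
    moreover have "(\<Prod>i\<in>I. count (A i) (\<eta> \<omega>)) \<ge> 0" by (intro prod_nonneg) (simp add: count_nonneg)
    ultimately show "norm (\<Prod>i\<in>I. count (A i) (\<eta> \<omega>)) \<le> norm (count (space X) (\<eta> \<omega>) ^ card I)"
      by simp
  qed
qed

lemma integrable_count: "A \<in> sets X \<Longrightarrow> integrable M (\<lambda>\<omega>. count A (\<eta> \<omega>))"
  using integrable_prod_count[of "{()}" "\<lambda>_. A"] by simp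

lemma count_increasing:
  assumes "A \<subseteq> {y. snd y = c}" "\<gamma> \<in> space configs" "\<gamma>' \<in> space configs"
    "twisted_le {y. snd y = c} \<gamma> \<gamma>'"
  shows "count A \<gamma> \<le> count A \<gamma>'"
  using assms unfolding count_def twisted_le_def space_configs by (auto intro!: card_mono)

text \<open>Taking the opposite colour as \<open>P\<close> reverses inclusion on the points of
  colour \<open>c\<close>.\<close>

lemma count_decreasing:
  assumes "A \<subseteq> {y. snd y = c}" "\<gamma> \<in> space configs" "\<gamma>' \<in> space configs"
    "twisted_le {y. snd y = opposite c} \<gamma> \<gamma>'"
  shows "count A \<gamma>' \<le> count A \<gamma>"
proof -
  have "\<gamma>' \<inter> A \<subseteq> \<gamma>' - {y. snd y = opposite c}" using assms(1) by auto
  then have "\<gamma>' \<inter> A \<subseteq> \<gamma> \<inter> A" using assms(4) unfolding twisted_le_def by blast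
  then show ?thesis using assms(2) unfolding count_def space_configs by (auto intro!: card_mono)
qed

text \<open>Counts truncated at \<open>m\<close> are bounded and increasing, so
  \<open>expect_prod\<close> applies. Only the left side needs a limit: on the right the truncated
  product is at most the full one.\<close>

theorem count_product_correlation:
  assumes I: "finite I" and A: "\<And>i. i \<in> I \<Longrightarrow> A i \<in> sets X" "\<And>i. i \<in> I \<Longrightarrow> A i \<subseteq> {y. snd y = c}"
  shows "(\<Prod>i\<in>I. expect (count (A i))) \<le> expect (\<lambda>\<gamma>. \<Prod>i\<in>I. count (A i) \<gamma>)"
proof (rule LIMSEQ_le_const2)
  define f where "f m i \<gamma> = min (count (A i) \<gamma>) (real m)" for m i \<gamma>
  have fm: "f m i \<in> borel_measurable configs" if "i \<in> I" for m i
    unfolding f_def[abs_def] using count_measurable[OF A(1)[OF that]] by simp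
  show "(\<lambda>m. \<Prod>i\<in>I. expect (f m i)) \<longlonglongrightarrow> (\<Prod>i\<in>I. expect (count (A i)))"
  proof (rule tendsto_prod)
    fix i assume i: "i \<in> I"
    show "(\<lambda>m. expect (f m i)) \<longlonglongrightarrow> expect (count (A i))"
      unfolding expect_def
    proof (rule integral_dominated_convergence[where w = "\<lambda>\<omega>. count (A i) (\<eta> \<omega>)"])
      show "AE \<omega> in M. (\<lambda>m. f m i (\<eta> \<omega>)) \<longlonglongrightarrow> count (A i) (\<eta> \<omega>)"
      proof (intro AE_I2 tendsto_eventually)
        fix \<omega>
        show "\<forall>\<^sub>F m in sequentially. f m i (\<eta> \<omega>) = count (A i) (\<eta> \<omega>)"
          using eventually_ge_at_top[of "card (\<eta> \<omega> \<inter> A i)"]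
          by eventually_elim (simp add: f_def count_def)
      qed
      show "(\<lambda>\<omega>. f m i (\<eta> \<omega>)) \<in> borel_measurable M" for m
        by (intro \<eta>_measurable fm i)
    qed (use i A count_nonneg in \<open>auto simp: f_def intro: integrable_count \<eta>_measurable count_measurable\<close>)
  qed
  have "(\<Prod>i\<in>I. expect (f m i)) \<le> expect (\<lambda>\<gamma>. \<Prod>i\<in>I. count (A i) \<gamma>)" for m
  proof -
    have inc: "increasing_statistic c (f m i)" if i: "i \<in> I" for i
      unfolding increasing_statistic_def
    proof (intro conjI ballI impI)
      show "bounded_statistic (f m i)"
        by (rule bounded_statisticI[of _ "real m"]) (auto simp: fm[OF i] f_def count_nonneg)
      fix \<gamma> \<gamma>' assume "\<gamma> \<in> space configs" "\<gamma>' \<in> space configs" "twisted_le {y. snd y = c} \<gamma> \<gamma>'"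
      then have "count (A i) \<gamma> \<le> count (A i) \<gamma>'" by (rule count_increasing[OF A(2)[OF i]])
      then show "f m i \<gamma> \<le> f m i \<gamma>'" by (simp add: f_def)
    qed (simp add: f_def count_nonneg)
    have "(\<Prod>i\<in>I. expect (f m i)) \<le> expect (\<lambda>\<gamma>. \<Prod>i\<in>I. f m i \<gamma>)"
      by (rule expect_prod(2)[OF I inc])
    also have "\<dots> \<le> expect (\<lambda>\<gamma>. \<Prod>i\<in>I. count (A i) \<gamma>)"
      unfolding expect_def
    proof (rule integral_mono)
      have "bounded_statistic (\<lambda>\<gamma>. \<Prod>i\<in>I. f m i \<gamma>)"
        using expect_prod(1)[OF I inc] by (simp add: increasing_statistic_def)
      then show "integrable M (\<lambda>\<omega>. \<Prod>i\<in>I. f m i (\<eta> \<omega>))" by (rule bounded_statistic_integrable)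
      show "integrable M (\<lambda>\<omega>. \<Prod>i\<in>I. count (A i) (\<eta> \<omega>))" by (rule integrable_prod_count[OF I A(1)])
      show "(\<Prod>i\<in>I. f m i (\<eta> \<omega>)) \<le> (\<Prod>i\<in>I. count (A i) (\<eta> \<omega>))" for \<omega>
        by (intro prod_mono) (auto simp: f_def count_nonneg)
    qed
    finally show ?thesis .
  qed
  then show "\<exists>N. \<forall>m\<ge>N. (\<Prod>i\<in>I. expect (f m i)) \<le> expect (\<lambda>\<gamma>. \<Prod>i\<in>I. count (A i) \<gamma>)" by blast
qed

section \<open>Void probabilities\<close>

definition void :: "('a \<times> color) set \<Rightarrow> ('a \<times> color) set \<Rightarrow> real" where
  "void A \<gamma> = (if count A \<gamma> = 0 then 1 else 0)"

text \<open>In the order of the opposite colour the points of colour \<open>c\<close> decrease,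
  which makes emptiness an increasing event.\<close>

lemma void_increasing:
  assumes "A \<in> sets X" "A \<subseteq> {y. snd y = c}"
  shows "increasing_statistic (opposite c) (void A)"
  unfolding increasing_statistic_def
proof (intro conjI ballI impI)
  have "{\<gamma> \<in> space configs. count A \<gamma> = 0} \<in> sets configs"
    using count_measurable[OF assms(1)] by (intro borel_measurable_eq) auto
  then have "void A \<in> borel_measurable configs"
    unfolding void_def[abs_def] by (intro measurable_If) auto
  then show "bounded_statistic (void A)"
    by (rule bounded_statisticI[of _ 1]) (simp add: void_def)
  fix \<gamma> \<gamma>' assume "\<gamma> \<in> space configs" "\<gamma>' \<in> space configs" "twisted_le {y. snd y = opposite c} \<gamma> \<gamma>'"
  then have "count A \<gamma>' \<le> count A \<gamma>" by (rule count_decreasing[OF assms(2)])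
  then show "void A \<gamma> \<le> void A \<gamma>'" using count_nonneg[of A \<gamma>'] by (simp add: void_def)
qed (simp add: void_def)

text \<open>First-moment bound: a nonzero count is at least \<open>1\<close>, so
  \<open>count A + void A \<ge> 1\<close> pointwise.\<close>

lemma expect_void_ge:
  assumes "A \<in> sets X" "A \<subseteq> {y. snd y = c}"
  shows "1 - expect (count A) \<le> expect (void A)"
proof -
  have "expect (count A) + expect (void A) = (\<integral>\<omega>. count A (\<eta> \<omega>) + void A (\<eta> \<omega>) \<partial>M)"
    unfolding expect_def using void_increasing[OF assms]
    by (intro Bochner_Integration.integral_add[symmetric] integrable_count assms bounded_statistic_integrable)
      (simp add: increasing_statistic_def)
  also have "\<dots> \<ge> (\<integral>\<omega>. 1 \<partial>M)"
  proof (rule integral_mono)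
    show "integrable M (\<lambda>\<omega>. count A (\<eta> \<omega>) + void A (\<eta> \<omega>))"
      using void_increasing[OF assms]
      by (intro Bochner_Integration.integrable_add integrable_count assms bounded_statistic_integrable)
        (simp add: increasing_statistic_def)
    show "1 \<le> count A (\<eta> \<omega>) + void A (\<eta> \<omega>)" for \<omega>
      by (auto simp: void_def count_def)
  qed simp
  finally show ?thesis by (simp add: M.prob_space)
qed

text \<open>The count of a single point is bounded by \<open>1\<close>, so its mean is given by the
  moment series, whose terms all vanish.\<close>

lemma expect_count_singleton:
  assumes "y \<in> space X"
  shows "expect (count {y}) = 0"
proof -
  have "bounded_statistic (count {y})"
  proof (rule bounded_statisticI[of _ 1])
    show "count {y} \<in> borel_measurable configs" using assms by (intro count_measurable singleton_sets)
    show "\<bar>count {y} \<gamma>\<bar> \<le> 1" for \<gamma>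
      using card_mono[of "{y}" "\<gamma> \<inter> {y}"] by (simp add: count_def)
  qed
  then show ?thesis using moment_count_null[OF assms] by (simp add: expect_eq)
qed

text \<open>The mean measure is finite and has no atoms: as the radius shrinks, the counts converge
  to the count at \<open>(p, c)\<close>, dominated by the integrable total, and the limit has mean
  \<open>0\<close>.\<close>

lemma small_ball:
  assumes p: "p \<in> D" and "\<epsilon> > 0"
  shows "\<exists>r>0. expect (count ((ball p r \<inter> D) \<times> {c})) < \<epsilon>"
proof -
  let ?A = "\<lambda>n. (ball p (inverse (real (Suc n))) \<inter> D) \<times> {c}"
  have D: "D \<in> sets borel" using compact by (simp add: compact_imp_closed)
  have A: "?A n \<in> sets X" for n
    using D by (intro Times_in_sets) auto
  have "(\<lambda>n. expect (count (?A n))) \<longlonglongrightarrow> expect (count {(p, c)})"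
    unfolding expect_def
  proof (rule integral_dominated_convergence[where w = "\<lambda>\<omega>. count (space X) (\<eta> \<omega>)"])
    show "AE \<omega> in M. (\<lambda>n. count (?A n) (\<eta> \<omega>)) \<longlonglongrightarrow> count {(p, c)} (\<eta> \<omega>)"
    proof (intro AE_I2 tendsto_eventually)
      fix \<omega> assume "\<omega> \<in> space M"
      then have fin: "finite (\<eta> \<omega>)" using \<eta>_space by (simp add: space_configs)
      \<comment> \<open>A single point other than \<open>(p, c)\<close> eventually leaves the balls;
        finiteness of the configuration then gives one threshold for all its points.\<close>
      have "\<forall>\<^sub>F n in sequentially. y \<in> ?A n \<longrightarrow> y = (p, c)" for y
      proof (cases "fst y = p")
        case False
        then have "dist p (fst y) > 0" by simp
        then have "\<forall>\<^sub>F n in sequentially. inverse (real (Suc n)) < dist p (fst y)"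
          using order_tendstoD(2)[OF LIMSEQ_inverse_real_of_nat] by blast
        then show ?thesis by eventually_elim auto
      next
        case True
        then have "y \<in> ?A n \<longrightarrow> y = (p, c)" for n by (cases y) simp
        then show ?thesis by (intro always_eventually) blast
      qed
      then have "\<forall>\<^sub>F n in sequentially. \<forall>y\<in>\<eta> \<omega>. y \<in> ?A n \<longrightarrow> y = (p, c)"
        using fin by (intro eventually_ball_finite) auto
      then show "\<forall>\<^sub>F n in sequentially. count (?A n) (\<eta> \<omega>) = count {(p, c)} (\<eta> \<omega>)"
      proof eventually_elim
        case (elim n)
        then have "\<eta> \<omega> \<inter> ?A n = \<eta> \<omega> \<inter> {(p, c)}" using p by auto
        then show ?case by (simp only: count_def)
      qed
    qed
    show "AE \<omega> in M. norm (count (?A n) (\<eta> \<omega>)) \<le> count (space X) (\<eta> \<omega>)" for n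
      using count_le_total \<eta>_space by (intro AE_I2) (simp add: count_nonneg)
    show "(\<lambda>\<omega>. count {(p, c)} (\<eta> \<omega>)) \<in> borel_measurable M"
      using p by (intro \<eta>_measurable count_measurable singleton_sets) (simp add: space_X)
    show "(\<lambda>\<omega>. count (?A n) (\<eta> \<omega>)) \<in> borel_measurable M" for n
      by (intro \<eta>_measurable count_measurable A)
    show "integrable M (\<lambda>\<omega>. count (space X) (\<eta> \<omega>))" by (intro integrable_count) simp
  qed
  then have "\<forall>\<^sub>F n in sequentially. expect (count (?A n)) < \<epsilon>"
    using expect_count_singleton[of "(p, c)"] p \<open>\<epsilon> > 0\<close> by (intro order_tendstoD(2)) (auto simp: space_X)
  then obtain n where "expect (count (?A n)) < \<epsilon>"
    unfolding eventually_sequentially by blast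
  then show ?thesis by (intro exI[of _ "inverse (real (Suc n))"]) simp
qed

text \<open>Compactness selects finitely many balls of small mean covering \<open>D\<close>; cutting
  \<open>B\<close> by them and making the pieces disjoint only lowers the means.\<close>

lemma small_partition:
  assumes B: "B \<in> sets borel" "B \<subseteq> D" and "\<epsilon> > 0"
  obtains C :: "nat \<Rightarrow> 'a set" and n where "\<And>i. C i \<in> sets borel" "\<And>i. C i \<subseteq> D" "disjoint_family C"
    "B = (\<Union>i<n. C i)" "\<And>i. i < n \<Longrightarrow> expect (count (C i \<times> {c})) < \<epsilon>"
proof -
  have "\<forall>p\<in>D. \<exists>r. r > 0 \<and> expect (count ((ball p r \<inter> D) \<times> {c})) < \<epsilon>"
    using small_ball[OF _ \<open>\<epsilon> > 0\<close>] by blast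
  then obtain r where r: "\<And>p. p \<in> D \<Longrightarrow> r p > 0 \<and> expect (count ((ball p (r p) \<inter> D) \<times> {c})) < \<epsilon>"
    using bchoice[of D] by meson
  obtain k where k: "k \<subseteq> D" "finite k" "D \<subseteq> (\<Union>p\<in>k. ball p (r p))"
  proof (rule compactE_image[OF compact, of D "\<lambda>p. ball p (r p)"])
    show "D \<subseteq> (\<Union>p\<in>D. ball p (r p))" using r by force
  qed auto
  obtain ps where ps: "set ps = k" using k(2) finite_list by blast
  \<comment> \<open>The empty default past the list extends the pieces to a sequence, as
    \<open>disjointed\<close> expects.\<close>
  define A where "A i = (if i < length ps then B \<inter> ball (ps ! i) (r (ps ! i)) else {})" for i
  have Ab: "A i \<in> sets borel" for i using B by (auto simp: A_def)
  have D: "D \<in> sets borel" using compact by (simp add: compact_imp_closed)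
  show ?thesis
  proof (rule that[of "disjointed A" "length ps"])
    show Cb: "disjointed A i \<in> sets borel" for i
      using sets.range_disjointed_sets[of A borel] Ab by blast
    show CD: "disjointed A i \<subseteq> D" for i
      using disjointed_subset[of A i] B by (auto simp: A_def split: if_splits)
    show "disjoint_family (disjointed A)" by (rule disjoint_family_disjointed)
    have "B = (\<Union>i<length ps. A i)"
    proof
      show "B \<subseteq> (\<Union>i<length ps. A i)"
      proof
        fix x assume x: "x \<in> B"
        then obtain p where "p \<in> k" "x \<in> ball p (r p)" using B k by blast
        then obtain i where "i < length ps" "x \<in> ball (ps ! i) (r (ps ! i))"
          using ps by (metis in_set_conv_nth)
        then show "x \<in> (\<Union>i<length ps. A i)" using x by (auto simp: A_def)
      qed
    qed (auto simp: A_def)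
    then show "B = (\<Union>i<length ps. disjointed A i)"
      using finite_UN_disjointed_eq[of A "length ps"] by (simp add: atLeast0LessThan)
    fix i assume i: "i < length ps"
    then have p: "ps ! i \<in> D" using ps k by auto
    have "expect (count (disjointed A i \<times> {c})) \<le> expect (count ((ball (ps ! i) (r (ps ! i)) \<inter> D) \<times> {c}))"
      unfolding expect_def
    proof (rule integral_mono)
      have "disjointed A i \<subseteq> ball (ps ! i) (r (ps ! i)) \<inter> D"
        using disjointed_subset[of A i] CD[of i] i by (auto simp: A_def)
      then show "count (disjointed A i \<times> {c}) (\<eta> \<omega>) \<le> count ((ball (ps ! i) (r (ps ! i)) \<inter> D) \<times> {c}) (\<eta> \<omega>)"
        if "\<omega> \<in> space M" for \<omega>
        using \<eta>_space[OF that] by (intro count_mono) auto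
      show "integrable M (\<lambda>\<omega>. count (disjointed A i \<times> {c}) (\<eta> \<omega>))"
        by (intro integrable_count Times_in_sets Cb CD)
      show "integrable M (\<lambda>\<omega>. count ((ball (ps ! i) (r (ps ! i)) \<inter> D) \<times> {c}) (\<eta> \<omega>))"
        using D by (intro integrable_count Times_in_sets) auto
    qed
    then show "expect (count (disjointed A i \<times> {c})) < \<epsilon>" using r[OF p] by linarith
  qed
qed

text \<open>The void events of the pieces are positively correlated, so their first-moment bounds
  \<open>1 - u i\<close> multiply. The pieces have means at most \<open>\<epsilon>\<close>, which
  controls the error in the exponent.\<close>

lemma void_lower_bound:
  fixes c :: color
  assumes B: "B \<in> sets borel" "B \<subseteq> D" and \<epsilon>: "0 < \<epsilon>" "\<epsilon> \<le> 1/2"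
  defines "v \<equiv> expect (count (B \<times> {c}))"
  shows "exp (- v - 2 * \<epsilon> * v) \<le> expect (void (B \<times> {c}))"
proof -
  obtain C :: "nat \<Rightarrow> 'a set" and n where C: "\<And>i. C i \<in> sets borel" "\<And>i. C i \<subseteq> D" "disjoint_family C"
    "B = (\<Union>i<n. C i)" "\<And>i. i < n \<Longrightarrow> expect (count (C i \<times> {c})) < \<epsilon>"
    using small_partition[OF B \<epsilon>(1), of c] by blast
  define A where "A i = C i \<times> {c}" for i
  define u where "u i = expect (count (A i))" for i
  have A: "A i \<in> sets X" "A i \<subseteq> {y. snd y = c}" for i
    using C by (auto simp: A_def intro: Times_in_sets)
  have u: "0 \<le> u i" for i
    unfolding u_def expect_def by (intro integral_nonneg_AE AE_I2 count_nonneg)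
  have u\<epsilon>: "u i \<le> \<epsilon>" if "i < n" for i
    using C(5)[OF that] by (simp add: u_def A_def)
  have count_sum: "count (B \<times> {c}) \<gamma> = (\<Sum>i<n. count (A i) \<gamma>)" if "\<gamma> \<in> space configs" for \<gamma>
  proof -
    have "\<gamma> \<inter> B \<times> {c} = (\<Union>i<n. \<gamma> \<inter> A i)" by (auto simp: C(4) A_def)
    moreover have "card (\<Union>i<n. \<gamma> \<inter> A i) = (\<Sum>i<n. card (\<gamma> \<inter> A i))"
      using that C(3) by (intro card_UN_disjoint)
        (auto simp: A_def space_configs disjoint_family_on_def)
    ultimately show ?thesis by (simp add: count_def)
  qed
  have v: "v = (\<Sum>i<n. u i)"
  proof -
    have "v = (\<integral>\<omega>. (\<Sum>i<n. count (A i) (\<eta> \<omega>)) \<partial>M)"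
      unfolding v_def expect_def using count_sum \<eta>_space
      by (intro Bochner_Integration.integral_cong) auto
    also have "\<dots> = (\<Sum>i<n. u i)"
      unfolding u_def expect_def by (intro Bochner_Integration.integral_sum integrable_count A)
    finally show ?thesis .
  qed
  \<comment> \<open>From \<open>ln (1 - u) \<ge> - u - 2 * u ^ 2\<close> for
    \<open>0 \<le> u \<le> 1/2\<close>; \<open>u \<le> \<epsilon>\<close> replaces the quadratic
    error by \<open>2 * \<epsilon> * u\<close>, which sums to
    \<open>2 * \<epsilon> * v\<close>.\<close>
  have "- v - 2 * \<epsilon> * v \<le> (\<Sum>i<n. ln (1 - u i))"
  proof -
    have "- v - 2 * \<epsilon> * v = (\<Sum>i<n. - u i - 2 * \<epsilon> * u i)"
      by (simp add: v sum_subtractf sum_negf sum_distrib_left)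
    also have "\<dots> \<le> (\<Sum>i<n. ln (1 - u i))"
    proof (rule sum_mono)
      fix i assume "i \<in> {..<n}"
      then have i: "u i \<le> \<epsilon>" using u\<epsilon> by simp
      have "u i * u i \<le> \<epsilon> * u i" using i u by (intro mult_right_mono)
      then show "- u i - 2 * \<epsilon> * u i \<le> ln (1 - u i)"
        using ln_one_minus_pos_lower_bound[OF u[of i]] i \<epsilon> by (simp add: power2_eq_square)
    qed
    finally show ?thesis .
  qed
  then have "exp (- v - 2 * \<epsilon> * v) \<le> (\<Prod>i<n. exp (ln (1 - u i)))"
    by (simp add: exp_sum[symmetric])
  also have "\<dots> = (\<Prod>i<n. 1 - u i)"
    using u\<epsilon> \<epsilon> by (intro prod.cong refl) (force intro!: exp_ln)
  also have "\<dots> \<le> (\<Prod>i<n. expect (void (A i)))"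
  proof (rule prod_mono)
    fix i assume "i \<in> {..<n}"
    then show "0 \<le> 1 - u i \<and> 1 - u i \<le> expect (void (A i))"
      using expect_void_ge[OF A(1,2), of i] u\<epsilon>[of i] \<epsilon> by (auto simp: u_def)
  qed
  also have "\<dots> \<le> expect (\<lambda>\<gamma>. \<Prod>i<n. void (A i) \<gamma>)"
    by (rule expect_prod(2)[where c = "opposite c"]) (auto intro!: void_increasing A)
  also have "\<dots> = expect (void (B \<times> {c}))"
    unfolding expect_def
  proof (rule Bochner_Integration.integral_cong[OF refl])
    fix \<omega> assume "\<omega> \<in> space M"
    then have "count (B \<times> {c}) (\<eta> \<omega>) = 0 \<longleftrightarrow> (\<forall>i<n. count (A i) (\<eta> \<omega>) = 0)"
      using count_sum[OF \<eta>_space] by (simp add: sum_nonneg_eq_0_iff count_nonneg Ball_def)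
    then show "(\<Prod>i<n. void (A i) (\<eta> \<omega>)) = void (B \<times> {c}) (\<eta> \<omega>)"
      by (auto simp: void_def)
  qed
  finally show ?thesis .
qed

theorem void_probability:
  assumes B: "B \<in> sets borel" "B \<subseteq> D"
  shows "exp (- expect (count (B \<times> {c}))) \<le> expect (void (B \<times> {c}))"
proof -
  define v where "v = expect (count (B \<times> {c}))"
  have "(\<lambda>n. exp (- v - 2 * inverse (real (Suc n)) * v)) \<longlonglongrightarrow> exp (- v - 2 * 0 * v)"
    by (intro tendsto_intros LIMSEQ_inverse_real_of_nat)
  \<comment> \<open>With \<open>\<epsilon> = 1 / (n + 1)\<close>, the condition
    \<open>\<epsilon> \<le> 1/2\<close> is the reason for \<open>n \<ge> 1\<close>.\<close>
  moreover have "exp (- v - 2 * inverse (real (Suc n)) * v) \<le> expect (void (B \<times> {c}))" if "n \<ge> 1" for n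
    unfolding v_def by (rule void_lower_bound[OF B]) (use that in \<open>auto simp: field_simps\<close>)
  ultimately have "exp (- v - 2 * 0 * v) \<le> expect (void (B \<times> {c}))"
    by (intro LIMSEQ_le_const2) blast+
  then show ?thesis by (simp add: v_def)
qed

text \<open>Both inequalities come from the same correlation result, the product of counts with the
  order increasing in colour \<open>c\<close> and the void probability with the order increasing in
  the opposite colour.\<close>

theorem color_weakly_super_poissonian: "weakly_super_poissonian D M (\<lambda>\<omega>. points_of_color c (\<eta> \<omega>))"
  unfolding weakly_super_poissonian_def card_points_of_color count_def[symmetric]
proof (intro conjI allI impI)
  fix k :: nat and B :: "nat \<Rightarrow> 'a set"
  assume "(\<forall>i\<in>{1..k}. B i \<in> sets borel \<and> B i \<subseteq> D) \<and> disjoint_family_on B {1..k}"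
  then have "B i \<times> {c} \<in> sets X" "B i \<times> {c} \<subseteq> {y. snd y = c}" if "i \<in> {1..k}" for i
    using that by (auto intro: Times_in_sets)
  from count_product_correlation[OF finite_atLeastAtMost this]
  show "(\<Prod>i=1..k. \<integral>\<omega>. count (B i \<times> {c}) (\<eta> \<omega>) \<partial>M)
      \<le> (\<integral>\<omega>. (\<Prod>i=1..k. count (B i \<times> {c}) (\<eta> \<omega>)) \<partial>M)"
    unfolding expect_def .
next
  fix B :: "'a set"
  assume B: "B \<in> sets borel \<and> B \<subseteq> D"
  let ?S = "{\<omega> \<in> space M. card (\<eta> \<omega> \<inter> B \<times> {c}) = 0}"
  have "expect (void (B \<times> {c})) = (\<integral>\<omega>. indicator ?S \<omega> \<partial>M)"
    unfolding expect_def
    by (intro Bochner_Integration.integral_cong refl) (simp add: void_def count_def indicator_def)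
  also have "\<dots> = measure M ?S" by (simp add: Int_absorb2 subset_eq)
  finally show "exp (- (\<integral>\<omega>. count (B \<times> {c}) (\<eta> \<omega>) \<partial>M)) \<le> measure M ?S"
    using void_probability[of B c] B unfolding expect_def by simp
qed

end

theorem mainTheorem5:
  fixes D :: "'a::metric_space set" and \<Lambda> :: "'a measure" and \<mu> :: real
    and M :: "'w measure" and \<eta> :: "'w \<Rightarrow> ('a \<times> color) set"
  assumes "compact D"
    and "radon_on D \<Lambda>"
    and "non_atomic \<Lambda>"
    and "\<mu> > 0"
    and "prob_space M"
    and "\<eta> \<in> measurable M (finite_configurations (colored_measure \<Lambda>))"
    and "has_fifm_law D \<Lambda> \<mu> M \<eta>"
  shows "weakly_super_poissonian D M (\<lambda>\<omega>. points_of_color Red (\<eta> \<omega>)) \<and>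
         weakly_super_poissonian D M (\<lambda>\<omega>. points_of_color Blue (\<eta> \<omega>))"
proof -
  interpret fifm_law D \<Lambda> \<mu> M \<eta>
    using assms by (intro fifm_law.intro fifm.intro fifm_law_axioms.intro)
  show ?thesis using color_weakly_super_poissonian by blast
qed

end
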